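(* (1) A symmetric colax monoidal functor $F : \mathcal V \to \mathcal W$ between symmetric monoidal categories is exact as a colax morphism of pseudo $\mathbf S$-algebras if and only if it is exact as a colax morphism of pseudo $\mathbf M$-algebras. (2) A braided colax monoidal functor $F : \mathcal V \to \mathcal W$ between braided monoidal categories is exact as a colax morphism of pseudo $\mathbf B$-algebras if and only if it is exact as a colax morphism of pseudo $\mathbf M$-algebras.
   Context: $\mathbf M$, $\mathbf S$ and $\mathbf B$ are the 2-monads on $\mathbf{CAT}$ (the 2-category of possibly large, locally small categories) for monoidal, symmetric monoidal and braided monoidal categories respectively. For a category $\mathcal V$, each of $\mathbf M\mathcal V$, $\mathbf S\mathcal V$, $\mathbf B\mathcal V$ has finite sequences of objects of $\mathcal V$ as objects, with morphisms only between sequences of equal length $n$: in $\mathbf M\mathcal V$ a morphism $(x_i)_i \to (y_i)_i$ is a family $x_i \to y_i$; in $\mathbf S\mathcal V$ it is a permutation $\rho \in \Sigma_n$ with a family $x_i \to y_{\rho i}$; in $\mathbf B\mathcal V$ it is a braid on $n$ strands, with underlying permutation $\rho$, with a family $x_i \to y_{\rho i}$. A monoidal (resp. symmetric, braided monoidal) category is a pseudo algebra via the $n$-ary tensor product functor $\bigotimes : T\mathcal V \to \mathcal V$, where $T = \mathbf M$ (resp. $\mathbf S$, $\mathbf B$), and a colax (resp. symmetric colax, braided colax) monoidal functor $F : \mathcal V \to \mathcal W$ is a colax morphism of pseudo $T$-algebras via $\overline F : F\bigotimes \to \bigotimes T(F)$ with components $\overline F_n : F\bigotimes_{i=1}^nZ_i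 \to \bigotimes_{i=1}^nFZ_i$. A lax square of categories, $p : P \to A$, $q : P \to B$, $f : A \to C$, $g : B \to C$, $\phi : fp \to gq$, is exact if for every natural transformation $\psi : h \to lf$ exhibiting $l$ as a pointwise left Kan extension of $h$ along $f$, the composite $(l\phi)(\psi p) : hp \to lgq$ exhibits $lg$ as a pointwise left Kan extension of $hp$ along $q$. $F$ is exact as a colax morphism of pseudo $T$-algebras if the lax square with $P = T\mathcal V$, $p = \bigotimes : T\mathcal V \to \mathcal V$, $q = T(F) : T\mathcal V \to T\mathcal W$, bottom $F : \mathcal V \to \mathcal W$, right side $\bigotimes : T\mathcal W \to \mathcal W$ and 2-cell $\overline F$ is exact. *)

theory Defs
  imports "HOL-Combinatorics.Permutations"
begin

section \<open>Categories, functors and natural transformations\<close>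

text \<open>
  Size: the hom-collections of a category are sets over a type, and there is no further size
  condition. Functions are only ever inspected on \<open>Obj\<close> and \<open>Arr\<close>; their values elsewhere are junk.
\<close>

record ('o, 'a) precat =
  Obj :: "'o set"
  Arr :: "'a set"
  Dom :: "'a \<Rightarrow> 'o"
  Cod :: "'a \<Rightarrow> 'o"
  Id :: "'o \<Rightarrow> 'a"
  Cmp :: "'a \<Rightarrow> 'a \<Rightarrow> 'a"  \<comment> \<open>\<open>Cmp C g f\<close> is \<open>g\<close> after \<open>f\<close>\<close>

definition hom :: "('o, 'a) precat \<Rightarrow> 'o \<Rightarrow> 'o \<Rightarrow> 'a set" where
  "hom C x y = {f \<in> Arr C. Dom C f = x \<and> Cod C f = y}"

locale category =
  fixes C :: "('o, 'a) precat"
  assumes Dom_Obj: "f \<in> Arr C \<Longrightarrow> Dom C f \<in> Obj C"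
    and Cod_Obj: "f \<in> Arr C \<Longrightarrow> Cod C f \<in> Obj C"
    and Id_hom: "x \<in> Obj C \<Longrightarrow> Id C x \<in> hom C x x"
    and Cmp_hom: "f \<in> hom C x y \<Longrightarrow> g \<in> hom C y z \<Longrightarrow> Cmp C g f \<in> hom C x z"
    and Id_left: "f \<in> hom C x y \<Longrightarrow> Cmp C (Id C y) f = f"
    and Id_right: "f \<in> hom C x y \<Longrightarrow> Cmp C f (Id C x) = f"
    and Cmp_assoc: "f \<in> hom C w x \<Longrightarrow> g \<in> hom C x y \<Longrightarrow> h \<in> hom C y z \<Longrightarrow>
      Cmp C h (Cmp C g f) = Cmp C (Cmp C h g) f"

definition is_iso :: "('o, 'a) precat \<Rightarrow> 'a \<Rightarrow> bool" where
  "is_iso C f \<longleftrightarrow> f \<in> Arr C \<and>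
     (\<exists>g \<in> hom C (Cod C f) (Dom C f). Cmp C g f = Id C (Dom C f) \<and> Cmp C f g = Id C (Cod C f))"

record ('o, 'a, 'p, 'b) fun_data =
  ob :: "'o \<Rightarrow> 'p"
  ar :: "'a \<Rightarrow> 'b"

definition is_functor ::
  "('o, 'a) precat \<Rightarrow> ('p, 'b) precat \<Rightarrow> ('o, 'a, 'p, 'b) fun_data \<Rightarrow> bool" where
  "is_functor C D F \<longleftrightarrow> category C \<and> category D \<and>
     (\<forall>x \<in> Obj C. ob F x \<in> Obj D \<and> ar F (Id C x) = Id D (ob F x)) \<and>
     (\<forall>f \<in> Arr C. ar F f \<in> hom D (ob F (Dom C f)) (ob F (Cod C f))) \<and>
     (\<forall>f \<in> Arr C. \<forall>g \<in> Arr C. Cod C f = Dom C g \<longrightarrow>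
        ar F (Cmp C g f) = Cmp D (ar F g) (ar F f))"

definition id_functor :: "('o, 'a, 'o, 'a) fun_data" where
  "id_functor = \<lparr>ob = id, ar = id\<rparr>"

definition comp_functor ::
  "('p, 'b, 'q, 'c) fun_data \<Rightarrow> ('o, 'a, 'p, 'b) fun_data \<Rightarrow> ('o, 'a, 'q, 'c) fun_data"
  (infixr \<open>\<circ>\<^sub>F\<close> 75) where
  "G \<circ>\<^sub>F F = \<lparr>ob = ob G \<circ> ob F, ar = ar G \<circ> ar F\<rparr>"

definition is_natural :: "('o, 'a) precat \<Rightarrow> ('p, 'b) precat \<Rightarrow>
    ('o, 'a, 'p, 'b) fun_data \<Rightarrow> ('o, 'a, 'p, 'b) fun_data \<Rightarrow> ('o \<Rightarrow> 'b) \<Rightarrow> bool" where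
  "is_natural C D F G \<tau> \<longleftrightarrow> is_functor C D F \<and> is_functor C D G \<and>
     (\<forall>x \<in> Obj C. \<tau> x \<in> hom D (ob F x) (ob G x)) \<and>
     (\<forall>f \<in> Arr C. Cmp D (\<tau> (Cod C f)) (ar F f) = Cmp D (ar G f) (\<tau> (Dom C f)))"

definition is_natural_iso :: "('o, 'a) precat \<Rightarrow> ('p, 'b) precat \<Rightarrow>
    ('o, 'a, 'p, 'b) fun_data \<Rightarrow> ('o, 'a, 'p, 'b) fun_data \<Rightarrow> ('o \<Rightarrow> 'b) \<Rightarrow> bool" where
  "is_natural_iso C D F G \<tau> \<longleftrightarrow> is_natural C D F G \<tau> \<and> (\<forall>x \<in> Obj C. is_iso D (\<tau> x))"


section \<open>Pointwise left Kan extensions and exact squares\<close>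

definition is_cocone :: "('j, 'k) precat \<Rightarrow> ('o, 'a) precat \<Rightarrow> ('j, 'k, 'o, 'a) fun_data \<Rightarrow>
    'o \<Rightarrow> ('j \<Rightarrow> 'a) \<Rightarrow> bool" where
  "is_cocone J M D m \<iota> \<longleftrightarrow> is_functor J M D \<and> m \<in> Obj M \<and>
     (\<forall>j \<in> Obj J. \<iota> j \<in> hom M (ob D j) m) \<and>
     (\<forall>k \<in> Arr J. Cmp M (\<iota> (Cod J k)) (ar D k) = \<iota> (Dom J k))"

definition is_colimit :: "('j, 'k) precat \<Rightarrow> ('o, 'a) precat \<Rightarrow> ('j, 'k, 'o, 'a) fun_data \<Rightarrow>
    'o \<Rightarrow> ('j \<Rightarrow> 'a) \<Rightarrow> bool" where
  "is_colimit J M D m \<iota> \<longleftrightarrow> is_cocone J M D m \<iota> \<and>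
     (\<forall>n \<kappa>. is_cocone J M D n \<kappa> \<longrightarrow>
        (\<exists>!t. t \<in> hom M m n \<and> (\<forall>j \<in> Obj J. Cmp M t (\<iota> j) = \<kappa> j)))"

text \<open>
  The comma category \<open>f / c\<close>: objects are pairs \<open>(a, u : f a \<rightarrow> c)\<close>; an arrow is recorded
  together with its source and target.
\<close>

definition comma :: "('o, 'a) precat \<Rightarrow> ('p, 'b) precat \<Rightarrow> ('o, 'a, 'p, 'b) fun_data \<Rightarrow> 'p \<Rightarrow>
    ('o \<times> 'b, ('o \<times> 'b) \<times> 'a \<times> ('o \<times> 'b)) precat" where
  "comma A C f c =
     \<lparr>Obj = {(x, u). x \<in> Obj A \<and> u \<in> hom C (ob f x) c},
      Arr = {((x, u), v, (y, w)). x \<in> Obj A \<and> y \<in> Obj A \<and> v \<in> hom A x y \<and>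
               u \<in> hom C (ob f x) c \<and> w \<in> hom C (ob f y) c \<and> Cmp C w (ar f v) = u},
      Dom = (\<lambda>(s, v, t). s),
      Cod = (\<lambda>(s, v, t). t),
      Id = (\<lambda>s. (s, Id A (fst s), s)),
      Cmp = (\<lambda>(s', v', t') (s, v, t). (s, Cmp A v' v, t'))\<rparr>"

definition comma_proj :: "('o \<times> 'b, ('o \<times> 'b) \<times> 'a \<times> ('o \<times> 'b), 'o, 'a) fun_data" where
  "comma_proj = \<lparr>ob = fst, ar = (\<lambda>(s, v, t). v)\<rparr>"

text \<open>
  \<open>\<psi> : h \<rightarrow> l f\<close> exhibits \<open>l\<close> as a pointwise left Kan extension of \<open>h : A \<rightarrow> M\<close> along
  \<open>f : A \<rightarrow> C\<close>: for each \<open>c\<close> the induced cocone exhibits \<open>l c\<close> as the colimit of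
  \<open>f / c \<rightarrow> A \<rightarrow> M\<close>.
\<close>

definition pointwise_left_kan :: "('o, 'a) precat \<Rightarrow> ('p, 'b) precat \<Rightarrow> ('m, 'n) precat \<Rightarrow>
    ('o, 'a, 'p, 'b) fun_data \<Rightarrow> ('o, 'a, 'm, 'n) fun_data \<Rightarrow> ('p, 'b, 'm, 'n) fun_data \<Rightarrow>
    ('o \<Rightarrow> 'n) \<Rightarrow> bool" where
  "pointwise_left_kan A C M f h l \<psi> \<longleftrightarrow>
     is_functor A C f \<and> is_functor A M h \<and> is_functor C M l \<and>
     is_natural A M h (l \<circ>\<^sub>F f) \<psi> \<and>
     (\<forall>c \<in> Obj C. is_colimit (comma A C f c) M (h \<circ>\<^sub>F comma_proj) (ob l c)
        (\<lambda>(x, u). Cmp M (ar l u) (\<psi> x)))"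

definition lax_square :: "('op, 'ap) precat \<Rightarrow> ('oa, 'aa) precat \<Rightarrow> ('ob, 'ab) precat \<Rightarrow>
    ('oc, 'ac) precat \<Rightarrow> ('op, 'ap, 'oa, 'aa) fun_data \<Rightarrow> ('op, 'ap, 'ob, 'ab) fun_data \<Rightarrow>
    ('oa, 'aa, 'oc, 'ac) fun_data \<Rightarrow> ('ob, 'ab, 'oc, 'ac) fun_data \<Rightarrow> ('op \<Rightarrow> 'ac) \<Rightarrow> bool" where
  "lax_square P A B C p q f g \<phi> \<longleftrightarrow>
     is_functor P A p \<and> is_functor P B q \<and> is_functor A C f \<and> is_functor B C g \<and>
     is_natural P C (f \<circ>\<^sub>F p) (g \<circ>\<^sub>F q) \<phi>"

text \<open>
  A formula cannot quantify over types, so the type over which the target categories \<open>M\<close> of the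
  Kan extensions range is a parameter of exactness.
\<close>

definition exact_square :: "('m, 'n) precat itself \<Rightarrow> ('op, 'ap) precat \<Rightarrow> ('oa, 'aa) precat \<Rightarrow>
    ('ob, 'ab) precat \<Rightarrow> ('oc, 'ac) precat \<Rightarrow> ('op, 'ap, 'oa, 'aa) fun_data \<Rightarrow>
    ('op, 'ap, 'ob, 'ab) fun_data \<Rightarrow> ('oa, 'aa, 'oc, 'ac) fun_data \<Rightarrow>
    ('ob, 'ab, 'oc, 'ac) fun_data \<Rightarrow> ('op \<Rightarrow> 'ac) \<Rightarrow> bool" where
  "exact_square T P A B C p q f g \<phi> \<longleftrightarrow> lax_square P A B C p q f g \<phi> \<and>
     (\<forall>(M :: ('m, 'n) precat) h l \<psi>. category M \<longrightarrow>
        pointwise_left_kan A C M f h l \<psi> \<longrightarrow>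
        pointwise_left_kan P B M q (h \<circ>\<^sub>F p) (l \<circ>\<^sub>F g)
          (\<lambda>x. Cmp M (ar l (\<phi> x)) (\<psi> (ob p x))))"


section \<open>The 2-monads for monoidal, symmetric monoidal and braided monoidal categories\<close>

text \<open>
  The three 2-monads are instances of one construction, which depends on groups \<open>G n\<close>
  (trivial groups, symmetric groups, braid groups) with homomorphisms to the permutations of
  \<open>{..<n}\<close> and with an operadic substitution. Positions are counted from 0, and
  \<open>gmult G n h g\<close> is \<open>h\<close> after \<open>g\<close>. For \<open>g \<in> G n\<close>, \<open>ks = [k\<^sub>0, ..., k\<^sub>n\<^sub>-\<^sub>1]\<close> and
  \<open>g\<^sub>i \<in> G k\<^sub>i\<close>, the element \<open>gsubst G g ks [g\<^sub>0, ..., g\<^sub>n\<^sub>-\<^sub>1]\<close> of \<open>G (k\<^sub>0 + ... + k\<^sub>n\<^sub>-\<^sub>1)\<close>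
  acts by \<open>g\<^sub>i\<close> inside the \<open>i\<close>-th block and then moves the blocks as prescribed by \<open>g\<close>.
\<close>

record 'g action_operad =
  gcarrier :: "nat \<Rightarrow> 'g set"
  gone :: "nat \<Rightarrow> 'g"
  gmult :: "nat \<Rightarrow> 'g \<Rightarrow> 'g \<Rightarrow> 'g"
  gperm :: "'g \<Rightarrow> nat \<Rightarrow> nat"
  gsubst :: "'g \<Rightarrow> nat list \<Rightarrow> 'g list \<Rightarrow> 'g"

text \<open>
  An arrow \<open>(g, fs)\<close> from \<open>xs\<close> to \<open>ys\<close> has \<open>fs ! i : xs ! i \<rightarrow> ys ! (gperm G g i)\<close>; hence \<open>xs\<close>
  and \<open>ys\<close> are determined by it.
\<close>

definition seq_cat :: "'g action_operad \<Rightarrow> ('o, 'a) precat \<Rightarrow> ('o list, 'g \<times> 'a list) precat" where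
  "seq_cat G V =
     \<lparr>Obj = lists (Obj V),
      Arr = {(g, fs). g \<in> gcarrier G (length fs) \<and> fs \<in> lists (Arr V)},
      Dom = (\<lambda>(g, fs). map (Dom V) fs),
      Cod = (\<lambda>(g, fs). map (\<lambda>j. Cod V (fs ! inv (gperm G g) j)) [0..<length fs]),
      Id = (\<lambda>xs. (gone G (length xs), map (Id V) xs)),
      Cmp = (\<lambda>(h, gs) (g, fs).
        (gmult G (length fs) h g,
         map (\<lambda>i. Cmp V (gs ! gperm G g i) (fs ! i)) [0..<length fs]))\<rparr>"

definition seq_map ::
  "('o, 'a, 'p, 'b) fun_data \<Rightarrow> ('o list, 'g \<times> 'a list, 'p list, 'g \<times> 'b list) fun_data" where
  "seq_map F = \<lparr>ob = map (ob F), ar = (\<lambda>(g, fs). (g, map (ar F) fs))\<rparr>"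

definition seq_nat :: "'g action_operad \<Rightarrow> ('o \<Rightarrow> 'b) \<Rightarrow> 'o list \<Rightarrow> 'g \<times> 'b list" where
  "seq_nat G \<tau> xs = (gone G (length xs), map \<tau> xs)"

definition seq_unit :: "'g action_operad \<Rightarrow> ('o, 'a, 'o list, 'g \<times> 'a list) fun_data" where
  "seq_unit G = \<lparr>ob = (\<lambda>x. [x]), ar = (\<lambda>f. (gone G 1, [f]))\<rparr>"

definition seq_mult :: "'g action_operad \<Rightarrow>
    ('o list list, 'g \<times> ('g \<times> 'a list) list, 'o list, 'g \<times> 'a list) fun_data" where
  "seq_mult G =
     \<lparr>ob = concat,
      ar = (\<lambda>(g, ss). (gsubst G g (map (length \<circ> snd) ss) (map fst ss), concat (map snd ss)))\<rparr>"


subsection \<open>Trivial groups\<close>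

definition trivial_operad :: "unit action_operad" where
  "trivial_operad =
     \<lparr>gcarrier = (\<lambda>n. {()}),
      gone = (\<lambda>n. ()),
      gmult = (\<lambda>n h g. ()),
      gperm = (\<lambda>g. id),
      gsubst = (\<lambda>g ks gs. ())\<rparr>"


subsection \<open>Symmetric groups\<close>

definition block_offset :: "nat list \<Rightarrow> nat \<Rightarrow> nat" where
  "block_offset ks i = sum_list (take i ks)"

definition block_of :: "nat list \<Rightarrow> nat \<Rightarrow> nat" where
  "block_of ks m = (LEAST i. m < block_offset ks (Suc i))"

text \<open>
  The element \<open>a\<close> of block \<open>i\<close> goes to the element \<open>(\<rho>s ! i) a\<close> of block \<open>\<rho> i\<close>; the blocks that
  end up before that one are those \<open>i'\<close> with \<open>\<rho> i' < \<rho> i\<close>.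
\<close>

definition perm_subst :: "(nat \<Rightarrow> nat) \<Rightarrow> nat list \<Rightarrow> (nat \<Rightarrow> nat) list \<Rightarrow> nat \<Rightarrow> nat" where
  "perm_subst \<rho> ks \<rho>s m =
     (if m < sum_list ks then
        let i = block_of ks m; a = m - block_offset ks i
        in (\<Sum>i' \<in> {i'. i' < length ks \<and> \<rho> i' < \<rho> i}. ks ! i') + (\<rho>s ! i) a
      else m)"

definition symmetric_operad :: "(nat \<Rightarrow> nat) action_operad" where
  "symmetric_operad =
     \<lparr>gcarrier = (\<lambda>n. {\<rho>. \<rho> permutes {..<n}}),
      gone = (\<lambda>n. id),
      gmult = (\<lambda>n \<sigma> \<rho>. \<sigma> \<circ> \<rho>),
      gperm = (\<lambda>\<rho>. \<rho>),
      gsubst = perm_subst\<rparr>"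


subsection \<open>Braid groups\<close>

text \<open>
  Braids on \<open>n\<close> strands are words in the Artin generators modulo the Artin relations.
  The letter \<open>(True, i)\<close> is the generator crossing the strands in positions \<open>i\<close> and \<open>i + 1\<close>, and
  \<open>(False, i)\<close> is its inverse. Words are read from left to right in time order, so the braid
  \<open>v\<close> after \<open>u\<close> is represented by \<open>u @ v\<close>.
\<close>

type_synonym braid_word = "(bool \<times> nat) list"

definition braid_words :: "nat \<Rightarrow> braid_word set" where
  "braid_words n = {w. \<forall>(e, i) \<in> set w. Suc i < n}"

inductive artin_relation :: "braid_word \<Rightarrow> braid_word \<Rightarrow> bool" where
  cancel: "artin_relation [(e, i), (\<not> e, i)] []"
| far: "Suc i < j \<Longrightarrow> artin_relation [(True, i), (True, j)] [(True, j), (True, i)]"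
| near: "artin_relation [(True, i), (True, Suc i), (True, i)]
           [(True, Suc i), (True, i), (True, Suc i)]"

definition artin_step :: "nat \<Rightarrow> braid_word \<Rightarrow> braid_word \<Rightarrow> bool" where
  "artin_step n v w \<longleftrightarrow> v \<in> braid_words n \<and> w \<in> braid_words n \<and>
     (\<exists>s t r r'. artin_relation r r' \<and> v = s @ r @ t \<and> w = s @ r' @ t)"

definition braid_class :: "nat \<Rightarrow> braid_word \<Rightarrow> braid_word set" where
  "braid_class n w = {v \<in> braid_words n. equivclp (artin_step n) w v}"

fun word_perm :: "braid_word \<Rightarrow> nat \<Rightarrow> nat" where
  "word_perm [] = id"
| "word_perm ((e, i) # w) = word_perm w \<circ> transpose i (Suc i)"

text \<open>
  \<open>block_crossing e d a b\<close> crosses the \<open>a\<close> strands starting at position \<open>d\<close> with the next \<open>b\<close>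
  strands; the last strand of the left block moves first. \<open>cable w ks\<close> replaces the strand
  starting in position \<open>i\<close> by \<open>ks ! i\<close> parallel strands.
\<close>

definition block_crossing :: "bool \<Rightarrow> nat \<Rightarrow> nat \<Rightarrow> nat \<Rightarrow> braid_word" where
  "block_crossing e d a b = concat (map (\<lambda>s. map (Pair e) [d + s..<d + s + b]) (rev [0..<a]))"

fun cable :: "braid_word \<Rightarrow> nat list \<Rightarrow> braid_word" where
  "cable [] ks = []"
| "cable ((e, i) # w) ks =
     block_crossing e (block_offset ks i) (ks ! i) (ks ! Suc i) @
     cable w (ks[i := ks ! Suc i, Suc i := ks ! i])"

definition juxtapose :: "nat list \<Rightarrow> braid_word list \<Rightarrow> braid_word" where
  "juxtapose ks ws =
     concat (map (\<lambda>i. map (\<lambda>(e, j). (e, block_offset ks i + j)) (ws ! i)) [0..<length ks])"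

text \<open>The operations on classes are defined by applying those on words to all representatives.\<close>

definition braid_operad :: "braid_word set action_operad" where
  "braid_operad =
     \<lparr>gcarrier = (\<lambda>n. braid_class n ` braid_words n),
      gone = (\<lambda>n. braid_class n []),
      gmult = (\<lambda>n h g. \<Union>u \<in> g. \<Union>v \<in> h. braid_class n (u @ v)),
      gperm = (\<lambda>g. the_elem (word_perm ` g)),
      gsubst = (\<lambda>g ks gs. \<Union>w \<in> g. \<Union>ws \<in> {ws. list_all2 (\<in>) ws gs}.
        braid_class (sum_list ks) (juxtapose ks ws @ cable w ks))\<rparr>"


section \<open>Pseudo algebras and colax morphisms\<close>

record ('g, 'o, 'a) alg_data =
  carr :: "('o, 'a) precat"
  tens :: "('o list, 'g \<times> 'a list, 'o, 'a) fun_data"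
  unitor :: "'o \<Rightarrow> 'a"              \<comment> \<open>\<open>x \<rightarrow> \<Otimes>[x]\<close>\<close>
  assoc :: "'o list list \<Rightarrow> 'a"     \<comment> \<open>\<open>\<Otimes>\<^sub>i\<Otimes>\<^sub>j x\<^sub>i\<^sub>j \<rightarrow> \<Otimes>\<^sub>i\<^sub>j x\<^sub>i\<^sub>j\<close>\<close>

definition pseudo_algebra :: "'g action_operad \<Rightarrow> ('g, 'o, 'a) alg_data \<Rightarrow> bool" where
  "pseudo_algebra G A \<longleftrightarrow>
     (let V = carr A; TV = seq_cat G V; TTV = seq_cat G TV; TTTV = seq_cat G TTV;
          t = tens A; \<iota> = unitor A; \<alpha> = assoc A in
      category V \<and> is_functor TV V t \<and>
      is_natural_iso V V id_functor (t \<circ>\<^sub>F seq_unit G) \<iota> \<and>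
      is_natural_iso TTV V (t \<circ>\<^sub>F seq_map t) (t \<circ>\<^sub>F seq_mult G) \<alpha> \<and>
      (\<forall>xs \<in> Obj TV.
         Cmp V (\<alpha> [xs]) (\<iota> (ob t xs)) = Id V (ob t xs) \<and>
         Cmp V (\<alpha> (map (\<lambda>x. [x]) xs)) (ar t (seq_nat G \<iota> xs)) = Id V (ob t xs)) \<and>
      (\<forall>xsss \<in> Obj TTTV.
         Cmp V (\<alpha> (map concat xsss)) (ar t (seq_nat G \<alpha> xsss)) =
         Cmp V (\<alpha> (concat xsss)) (\<alpha> (map (map (ob t)) xsss))))"

definition colax_morphism :: "'g action_operad \<Rightarrow> ('g, 'o, 'a) alg_data \<Rightarrow>
    ('g, 'p, 'b) alg_data \<Rightarrow> ('o, 'a, 'p, 'b) fun_data \<Rightarrow> ('o list \<Rightarrow> 'b) \<Rightarrow> bool" where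
  "colax_morphism G A B F \<Phi> \<longleftrightarrow>
     (let V = carr A; TV = seq_cat G V; TTV = seq_cat G TV; W = carr B in
      pseudo_algebra G A \<and> pseudo_algebra G B \<and> is_functor V W F \<and>
      is_natural TV W (F \<circ>\<^sub>F tens A) (tens B \<circ>\<^sub>F seq_map F) \<Phi> \<and>
      (\<forall>x \<in> Obj V. Cmp W (\<Phi> [x]) (ar F (unitor A x)) = unitor B (ob F x)) \<and>
      (\<forall>xss \<in> Obj TTV.
         Cmp W (\<Phi> (concat xss)) (ar F (assoc A xss)) =
         Cmp W (assoc B (map (map (ob F)) xss))
           (Cmp W (ar (tens B) (seq_nat G \<Phi> xss)) (\<Phi> (map (ob (tens A)) xss)))))"

definition exact_colax_morphism :: "('m, 'n) precat itself \<Rightarrow> 'g action_operad \<Rightarrow>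
    ('g, 'o, 'a) alg_data \<Rightarrow> ('g, 'p, 'b) alg_data \<Rightarrow> ('o, 'a, 'p, 'b) fun_data \<Rightarrow>
    ('o list \<Rightarrow> 'b) \<Rightarrow> bool" where
  "exact_colax_morphism T G A B F \<Phi> \<longleftrightarrow>
     exact_square T (seq_cat G (carr A)) (carr A) (seq_cat G (carr B)) (carr B)
       (tens A) (seq_map F) F (tens B) \<Phi>"

text \<open>
  Restriction along the inclusion of sequences with families of arrows into sequences with
  \<open>G\<close>-labelled families: the underlying monoidal category. The underlying colax morphism of
  \<open>(F, \<Phi>)\<close> has the same components.
\<close>

definition seq_incl ::
  "'g action_operad \<Rightarrow> ('o list, unit \<times> 'a list, 'o list, 'g \<times> 'a list) fun_data" where
  "seq_incl G = \<lparr>ob = id, ar = (\<lambda>(g, fs). (gone G (length fs), fs))\<rparr>"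

definition underlying_monoidal :: "'g action_operad \<Rightarrow> ('g, 'o, 'a) alg_data \<Rightarrow>
    (unit, 'o, 'a) alg_data" where
  "underlying_monoidal G A =
     \<lparr>carr = carr A, tens = tens A \<circ>\<^sub>F seq_incl G, unitor = unitor A, assoc = assoc A\<rparr>"

end

theory Submission
  imports Defs
begin

text \<open>
  Let \<open>G\<close> be the family of symmetric or braid groups and \<open>ys\<close> a sequence of objects of \<open>W\<close>. The
  comma category of unlabelled sequences over \<open>ys\<close> includes into that of \<open>G\<close>-labelled ones. The
  inclusion is essentially surjective: an arrow \<open>(g, fs) : F xs \<rightarrow> ys\<close> becomes unlabelled after
  permuting \<open>xs\<close> by \<open>g\<close>, and this permutation is an isomorphism. It is full because
  \<open>1 g = 1\<close> forces \<open>g = 1\<close>. So colimits over the two comma categories agree,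
  and the two exactness conditions ask for the same pointwise Kan extensions.
\<close>

section \<open>Functors, natural transformations and comma categories\<close>

text \<open>Between sequences alone, the inclusion of unlabelled into labelled ones is in general
  not full: a nontrivial permutation or braid has no unlabelled counterpart. Fullness appears only
  over a fixed \<open>ys\<close>, where an arrow has to commute with two structure maps that both
  carry the label 1. This comparison takes place in the group and not among permutations, so a
  nontrivial pure braid is excluded although its permutation is the identity. Inverses in the group
  give essential surjectivity. Both facts concern the categories \<open>T(F) / ys\<close>, which
  index the colimits; the tensor products enter only through the diagrams on them. Hence the
  argument is carried out once, for groups with a homomorphism to permutations, and then
  specialised.\<close>

lemma hom_Obj:
  assumes "category C" "f \<in> hom C x y"
  shows "x \<in> Obj C" "y \<in> Obj C"
  using assms category.Dom_Obj[of C f] category.Cod_Obj[of C f] by (auto simp: hom_def)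

lemma is_isoI:
  assumes "f \<in> hom C x y" "g \<in> hom C y x" "Cmp C g f = Id C x" "Cmp C f g = Id C y"
  shows "is_iso C f"
  using assms by (auto simp: is_iso_def hom_def)

lemma is_functorI:
  assumes "category C" "category D"
    and "\<And>x. x \<in> Obj C \<Longrightarrow> ob F x \<in> Obj D"
    and "\<And>x. x \<in> Obj C \<Longrightarrow> ar F (Id C x) = Id D (ob F x)"
    and "\<And>f x y. f \<in> hom C x y \<Longrightarrow> ar F f \<in> hom D (ob F x) (ob F y)"
    and "\<And>f g x y z. f \<in> hom C x y \<Longrightarrow> g \<in> hom C y z \<Longrightarrow>
      ar F (Cmp C g f) = Cmp D (ar F g) (ar F f)"
  shows "is_functor C D F"
  using assms unfolding is_functor_def hom_def by auto

lemma functor_category: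
  assumes "is_functor C D F"
  shows "category C" "category D"
  using assms by (auto simp: is_functor_def)

lemma functor_Obj: "is_functor C D F \<Longrightarrow> x \<in> Obj C \<Longrightarrow> ob F x \<in> Obj D"
  by (auto simp: is_functor_def)

lemma functor_Id: "is_functor C D F \<Longrightarrow> x \<in> Obj C \<Longrightarrow> ar F (Id C x) = Id D (ob F x)"
  by (auto simp: is_functor_def)

lemma functor_hom: "is_functor C D F \<Longrightarrow> f \<in> hom C x y \<Longrightarrow> ar F f \<in> hom D (ob F x) (ob F y)"
  by (auto simp: is_functor_def hom_def)

lemma functor_Cmp:
  "is_functor C D F \<Longrightarrow> f \<in> hom C x y \<Longrightarrow> g \<in> hom C y z \<Longrightarrow>
    ar F (Cmp C g f) = Cmp D (ar F g) (ar F f)"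
  by (auto simp: is_functor_def hom_def)

lemma ob_comp [simp]: "ob (G \<circ>\<^sub>F F) x = ob G (ob F x)"
  by (simp add: comp_functor_def)

lemma ar_comp [simp]: "ar (G \<circ>\<^sub>F F) f = ar G (ar F f)"
  by (simp add: comp_functor_def)

lemma comp_functor_assoc: "(H \<circ>\<^sub>F G) \<circ>\<^sub>F F = H \<circ>\<^sub>F (G \<circ>\<^sub>F F)"
  by (simp add: comp_functor_def o_assoc)

lemma is_functor_comp:
  assumes "is_functor C D F" "is_functor D E G"
  shows "is_functor C E (G \<circ>\<^sub>F F)"
proof (rule is_functorI)
  show "category C" "category E"
    using assms functor_category by blast+
qed (use assms in \<open>auto simp: functor_Obj functor_Id functor_Cmp[OF assms(1)]
      intro!: functor_hom functor_Cmp[OF assms(2)]\<close>)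

lemma natural_hom: "is_natural C D F G \<tau> \<Longrightarrow> x \<in> Obj C \<Longrightarrow> \<tau> x \<in> hom D (ob F x) (ob G x)"
  by (auto simp: is_natural_def)

lemma natural_Cmp:
  "is_natural C D F G \<tau> \<Longrightarrow> f \<in> hom C x y \<Longrightarrow> Cmp D (\<tau> y) (ar F f) = Cmp D (ar G f) (\<tau> x)"
  by (auto simp: is_natural_def hom_def)

lemma is_naturalI:
  assumes "is_functor C D F" "is_functor C D G"
    and "\<And>x. x \<in> Obj C \<Longrightarrow> \<tau> x \<in> hom D (ob F x) (ob G x)"
    and "\<And>f x y. f \<in> hom C x y \<Longrightarrow> Cmp D (\<tau> y) (ar F f) = Cmp D (ar G f) (\<tau> x)"
  shows "is_natural C D F G \<tau>"
  using assms unfolding is_natural_def hom_def by auto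

lemma natural_functor:
  assumes "is_natural C D F G \<tau>"
  shows "is_functor C D F" "is_functor C D G"
  using assms by (auto simp: is_natural_def)

lemma is_natural_whisker_right:
  assumes "is_natural C D F G \<tau>" "is_functor B C K"
  shows "is_natural B D (F \<circ>\<^sub>F K) (G \<circ>\<^sub>F K) (\<lambda>x. \<tau> (ob K x))"
proof (rule is_naturalI)
  show "is_functor B D (F \<circ>\<^sub>F K)" "is_functor B D (G \<circ>\<^sub>F K)"
    using is_functor_comp[OF assms(2)] natural_functor[OF assms(1)] by auto
qed (use natural_hom[OF assms(1)] natural_Cmp[OF assms(1)] functor_Obj[OF assms(2)]
      functor_hom[OF assms(2)] in auto)

lemma is_natural_whisker_left:
  assumes "is_natural C D F G \<tau>" "is_functor D E L"
  shows "is_natural C E (L \<circ>\<^sub>F F) (L \<circ>\<^sub>F G) (\<lambda>x. ar L (\<tau> x))"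
proof (rule is_naturalI)
  show "is_functor C E (L \<circ>\<^sub>F F)" "is_functor C E (L \<circ>\<^sub>F G)"
    using is_functor_comp[OF _ assms(2)] natural_functor[OF assms(1)] by auto
  show "ar L (\<tau> x) \<in> hom E (ob (L \<circ>\<^sub>F F) x) (ob (L \<circ>\<^sub>F G) x)" if "x \<in> Obj C" for x
    using natural_hom[OF assms(1) that] functor_hom[OF assms(2)] by simp
  fix f x y assume f: "f \<in> hom C x y"
  note F = natural_functor[OF assms(1)]
  have xy: "x \<in> Obj C" "y \<in> Obj C"
    using hom_Obj[OF functor_category(1)[OF F(1)] f] by auto
  have "Cmp E (ar L (\<tau> y)) (ar L (ar F f)) = ar L (Cmp D (\<tau> y) (ar F f))"
    by (rule functor_Cmp[OF assms(2) functor_hom[OF F(1) f] natural_hom[OF assms(1) xy(2)],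
          symmetric])
  also have "\<dots> = ar L (Cmp D (ar G f) (\<tau> x))"
    using natural_Cmp[OF assms(1) f] by simp
  also have "\<dots> = Cmp E (ar L (ar G f)) (ar L (\<tau> x))"
    by (rule functor_Cmp[OF assms(2) natural_hom[OF assms(1) xy(1)] functor_hom[OF F(2) f]])
  finally show "Cmp E (ar L (\<tau> y)) (ar (L \<circ>\<^sub>F F) f) = Cmp E (ar (L \<circ>\<^sub>F G) f) (ar L (\<tau> x))"
    by simp
qed

lemma is_natural_vertical:
  assumes "is_natural C D F G \<sigma>" "is_natural C D G H \<tau>"
  shows "is_natural C D F H (\<lambda>x. Cmp D (\<tau> x) (\<sigma> x))"
proof (rule is_naturalI)
  note F = natural_functor[OF assms(1)] natural_functor[OF assms(2)]
  note D = functor_category(2)[OF F(1)]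
  show "is_functor C D F" "is_functor C D H"
    using F by auto
  show "Cmp D (\<tau> x) (\<sigma> x) \<in> hom D (ob F x) (ob H x)" if "x \<in> Obj C" for x
    using category.Cmp_hom[OF D natural_hom[OF assms(1) that] natural_hom[OF assms(2) that]] .
  fix f x y assume f: "f \<in> hom C x y"
  have xy: "x \<in> Obj C" "y \<in> Obj C"
    using hom_Obj[OF functor_category(1)[OF F(1)] f] by auto
  note s = natural_hom[OF assms(1)] and t = natural_hom[OF assms(2)]
  have "Cmp D (Cmp D (\<tau> y) (\<sigma> y)) (ar F f) = Cmp D (\<tau> y) (Cmp D (\<sigma> y) (ar F f))"
    using category.Cmp_assoc[OF D functor_hom[OF F(1) f] s[OF xy(2)] t[OF xy(2)]] by simp
  also have "\<dots> = Cmp D (\<tau> y) (Cmp D (ar G f) (\<sigma> x))"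
    using natural_Cmp[OF assms(1) f] by simp
  also have "\<dots> = Cmp D (Cmp D (\<tau> y) (ar G f)) (\<sigma> x)"
    using category.Cmp_assoc[OF D s[OF xy(1)] functor_hom[OF F(2) f] t[OF xy(2)]] by simp
  also have "\<dots> = Cmp D (Cmp D (ar H f) (\<tau> x)) (\<sigma> x)"
    using natural_Cmp[OF assms(2) f] by simp
  also have "\<dots> = Cmp D (ar H f) (Cmp D (\<tau> x) (\<sigma> x))"
    using category.Cmp_assoc[OF D s[OF xy(1)] t[OF xy(1)] functor_hom[OF F(4) f]] by simp
  finally show "Cmp D (Cmp D (\<tau> y) (\<sigma> y)) (ar F f) = Cmp D (ar H f) (Cmp D (\<tau> x) (\<sigma> x))" .
qed

section \<open>Comma categories and the cocones indexed by them\<close>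

lemma comma_Obj_iff [simp]:
  "(x, u) \<in> Obj (comma A C f c) \<longleftrightarrow> x \<in> Obj A \<and> u \<in> hom C (ob f x) c"
  by (simp add: comma_def)

lemma comma_hom_iff:
  "((s, v, t) \<in> hom (comma A C f c) s' t') \<longleftrightarrow> s' = s \<and> t' = t \<and>
     s \<in> Obj (comma A C f c) \<and> t \<in> Obj (comma A C f c) \<and>
     v \<in> hom A (fst s) (fst t) \<and> Cmp C (snd t) (ar f v) = snd s"
  by (auto simp: comma_def hom_def)

lemma comma_homE:
  assumes "a \<in> hom (comma A C f c) s t"
  obtains v where "a = (s, v, t)" "s \<in> Obj (comma A C f c)" "t \<in> Obj (comma A C f c)"
    "v \<in> hom A (fst s) (fst t)" "Cmp C (snd t) (ar f v) = snd s"
  using assms by (cases a) (auto simp: comma_hom_iff)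

lemma comma_Cmp [simp]: "Cmp (comma A C f c) (s', v', t') (s, v, t) = (s, Cmp A v' v, t')"
  by (simp add: comma_def)

lemma comma_Id [simp]: "Id (comma A C f c) s = (s, Id A (fst s), s)"
  by (simp add: comma_def)

lemma category_comma:
  assumes f: "is_functor A C f"
  shows "category (comma A C f c)"
proof
  note A = functor_category(1)[OF f] and C = functor_category(2)[OF f]
  let ?K = "comma A C f c"
  show "Dom ?K a \<in> Obj ?K" "Cod ?K a \<in> Obj ?K" if "a \<in> Arr ?K" for a
    using that by (auto simp: comma_def)
  show "Id ?K s \<in> hom ?K s s" if "s \<in> Obj ?K" for s
    using that category.Id_hom[OF A] category.Id_right[OF C] functor_Id[OF f]
    by (cases s) (auto simp: comma_hom_iff)
  show "Cmp ?K b a \<in> hom ?K r t" if a: "a \<in> hom ?K r s" and b: "b \<in> hom ?K s t" for a b r s t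
  proof -
    obtain v where v: "a = (r, v, s)" "r \<in> Obj ?K" "s \<in> Obj ?K" "v \<in> hom A (fst r) (fst s)"
        "Cmp C (snd s) (ar f v) = snd r"
      using a by (rule comma_homE)
    obtain w where w: "b = (s, w, t)" "t \<in> Obj ?K" "w \<in> hom A (fst s) (fst t)"
        "Cmp C (snd t) (ar f w) = snd s"
      using b by (rule comma_homE)
    have "snd t \<in> hom C (ob f (fst t)) c"
      using w(2) by (cases t) auto
    then have "Cmp C (snd t) (ar f (Cmp A w v)) = snd r"
      using category.Cmp_assoc[OF C functor_hom[OF f v(4)] functor_hom[OF f w(3)]] v w
        functor_Cmp[OF f v(4) w(3)] by simp
    then show ?thesis
      using v w category.Cmp_hom[OF A v(4) w(3)] by (simp add: comma_hom_iff)
  qed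
  show "Cmp ?K (Id ?K t) a = a" "Cmp ?K a (Id ?K s) = a" if "a \<in> hom ?K s t" for a s t
    using that category.Id_left[OF A] category.Id_right[OF A] by (auto elim!: comma_homE)
  show "Cmp ?K d (Cmp ?K b a) = Cmp ?K (Cmp ?K d b) a"
    if "a \<in> hom ?K r s" "b \<in> hom ?K s t" "d \<in> hom ?K t u" for a b d r s t u
    using that category.Cmp_assoc[OF A] by (auto elim!: comma_homE)
qed

lemma is_functor_comma_proj:
  assumes f: "is_functor A C f"
  shows "is_functor (comma A C f c) A comma_proj"
proof (rule is_functorI)
  show "category (comma A C f c)" "category A"
    using category_comma[OF f] functor_category[OF f] by auto
qed (auto simp: comma_proj_def elim!: comma_homE)

text \<open>The inverse \<open>w\<close> of \<open>v\<close> in \<open>A\<close> is itself an arrow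
  over \<open>c\<close>: composing \<open>snd s\<close>, which is \<open>snd t\<close> after
  \<open>f v\<close>, with \<open>f w\<close> gives back \<open>snd t\<close>. So isomorphisms in
  the comma category can be found by looking in \<open>A\<close>.\<close>

lemma is_iso_comma:
  assumes f: "is_functor A C f" and a: "(s, v, t) \<in> hom (comma A C f c) s t"
    and v: "is_iso A v"
  shows "is_iso (comma A C f c) (s, v, t)"
proof -
  note A = functor_category(1)[OF f] and C = functor_category(2)[OF f]
  let ?K = "comma A C f c"
  have st: "s \<in> Obj ?K" "t \<in> Obj ?K" "v \<in> hom A (fst s) (fst t)" "Cmp C (snd t) (ar f v) = snd s"
    using a by (auto simp: comma_hom_iff)
  then obtain w where w: "w \<in> hom A (fst t) (fst s)" "Cmp A w v = Id A (fst s)"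
      "Cmp A v w = Id A (fst t)"
    using v by (auto simp: is_iso_def hom_def)
  have t: "snd t \<in> hom C (ob f (fst t)) c" "fst t \<in> Obj A"
    using st(2) by (cases t; auto)+
  have "Cmp C (snd s) (ar f w) = Cmp C (snd t) (Cmp C (ar f v) (ar f w))"
    using category.Cmp_assoc[OF C functor_hom[OF f w(1)] functor_hom[OF f st(3)] t(1)] st(4)
    by simp
  also have "\<dots> = Cmp C (snd t) (ar f (Id A (fst t)))"
    using functor_Cmp[OF f w(1) st(3)] w(3) by simp
  also have "\<dots> = snd t"
    using functor_Id[OF f t(2)] category.Id_right[OF C t(1)] by simp
  finally have "(t, w, s) \<in> hom ?K t s"
    using st w by (simp add: comma_hom_iff)
  then show ?thesis
    using w by (intro is_isoI[OF a]) auto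
qed

text \<open>At an arrow \<open>v\<close> over \<open>c\<close> the cocone equation is naturality of
  \<open>\<psi>\<close> at \<open>v\<close> followed by functoriality of \<open>l\<close>.
  Naturality therefore always supplies the cocone, and being a pointwise Kan extension is a question
  of universality only.\<close>

lemma is_cocone_comma:
  assumes \<psi>: "is_natural A M h (l \<circ>\<^sub>F f) \<psi>" and f: "is_functor A C f" and l: "is_functor C M l"
    and c: "c \<in> Obj C"
  shows "is_cocone (comma A C f c) M (h \<circ>\<^sub>F comma_proj) (ob l c) (\<lambda>(x, u). Cmp M (ar l u) (\<psi> x))"
proof -
  note h = natural_functor(1)[OF \<psi>] and M = functor_category(2)[OF l]
    and A = functor_category(1)[OF f]
  let ?K = "comma A C f c" and ?\<iota> = "\<lambda>(x, u). Cmp M (ar l u) (\<psi> x)"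
  have *: "Cmp M (?\<iota> t) (ar (h \<circ>\<^sub>F comma_proj) a) = ?\<iota> s" if a: "a \<in> hom ?K s t" for a s t
  proof -
    obtain v where v: "a = (s, v, t)" "s \<in> Obj ?K" "t \<in> Obj ?K" "v \<in> hom A (fst s) (fst t)"
        "Cmp C (snd t) (ar f v) = snd s"
      using a by (rule comma_homE)
    obtain x u y w where [simp]: "s = (x, u)" "t = (y, w)"
      by (cases s; cases t)
    have v': "x \<in> Obj A" "y \<in> Obj A" "v \<in> hom A x y" "w \<in> hom C (ob f y) c"
      "Cmp C w (ar f v) = u"
      using v by auto
    have \<psi>x: "\<psi> x \<in> hom M (ob h x) (ob l (ob f x))" and \<psi>y: "\<psi> y \<in> hom M (ob h y) (ob l (ob f y))"
      using natural_hom[OF \<psi> v'(1)] natural_hom[OF \<psi> v'(2)] by auto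
    note lv = functor_hom[OF l functor_hom[OF f v'(3)]] and lw = functor_hom[OF l v'(4)]
    have "Cmp M (Cmp M (ar l w) (\<psi> y)) (ar h v) = Cmp M (ar l w) (Cmp M (\<psi> y) (ar h v))"
      using category.Cmp_assoc[OF M functor_hom[OF h v'(3)] \<psi>y lw] by simp
    also have "\<dots> = Cmp M (ar l w) (Cmp M (ar l (ar f v)) (\<psi> x))"
      using natural_Cmp[OF \<psi> v'(3)] by simp
    also have "\<dots> = Cmp M (Cmp M (ar l w) (ar l (ar f v))) (\<psi> x)"
      by (rule category.Cmp_assoc[OF M \<psi>x lv lw])
    also have "\<dots> = Cmp M (ar l u) (\<psi> x)"
      using functor_Cmp[OF l functor_hom[OF f v'(3)] v'(4)] v'(5) by simp
    finally show ?thesis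
      using v(1) by (simp add: comma_proj_def)
  qed
  show ?thesis
    unfolding is_cocone_def
  proof (intro conjI ballI)
    show "is_functor ?K M (h \<circ>\<^sub>F comma_proj)"
      using is_functor_comp[OF is_functor_comma_proj[OF f] h] .
    show "ob l c \<in> Obj M"
      using functor_Obj[OF l c] .
    show "?\<iota> s \<in> hom M (ob (h \<circ>\<^sub>F comma_proj) s) (ob l c)" if "s \<in> Obj ?K" for s
    proof (cases s)
      case (Pair x u)
      then have "x \<in> Obj A" "u \<in> hom C (ob f x) c"
        using that by auto
      then show ?thesis
        using Pair category.Cmp_hom[OF M natural_hom[OF \<psi>, of x] , of "ar l u" "ob l c"]
          functor_hom[OF l, of u "ob f x" c] by (simp add: comma_proj_def)
    qed
    show "Cmp M (?\<iota> (Cod ?K a)) (ar (h \<circ>\<^sub>F comma_proj) a) = ?\<iota> (Dom ?K a)" if "a \<in> Arr ?K" for a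
      using * that by (simp add: hom_def)
  qed
qed


section \<open>Colimits along equivalences\<close>

lemma is_cocone_leg:
  "is_cocone J M D m \<iota> \<Longrightarrow> j \<in> Obj J \<Longrightarrow> \<iota> j \<in> hom M (ob D j) m"
  by (simp add: is_cocone_def)

lemma is_cocone_Cmp:
  "is_cocone J M D m \<iota> \<Longrightarrow> a \<in> hom J j k \<Longrightarrow> Cmp M (\<iota> k) (ar D a) = \<iota> j"
  by (auto simp: is_cocone_def hom_def)

lemma is_coconeI:
  assumes "is_functor J M D" "m \<in> Obj M"
    and "\<And>j. j \<in> Obj J \<Longrightarrow> \<iota> j \<in> hom M (ob D j) m"
    and "\<And>a j k. a \<in> hom J j k \<Longrightarrow> Cmp M (\<iota> k) (ar D a) = \<iota> j"
  shows "is_cocone J M D m \<iota>"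
  using assms unfolding is_cocone_def hom_def by auto

lemma is_cocone_restrict:
  assumes "is_cocone K M D m \<iota>" "is_functor J K I"
  shows "is_cocone J M (D \<circ>\<^sub>F I) m (\<lambda>j. \<iota> (ob I j))"
proof (rule is_coconeI)
  show "is_functor J M (D \<circ>\<^sub>F I)"
    using assms is_functor_comp by (auto simp: is_cocone_def)
  show "m \<in> Obj M"
    using assms(1) by (simp add: is_cocone_def)
qed (use is_cocone_leg[OF assms(1)] is_cocone_Cmp[OF assms(1)] functor_Obj[OF assms(2)]
      functor_hom[OF assms(2)] in auto)

text \<open>
  A cocone on \<open>D I\<close> extends along a choice of isomorphisms \<open>k \<rightarrow> I j\<close>; fullness makes the
  extension natural.
\<close>

lemma is_colimit_restrict:
  assumes I: "is_functor J K I" and \<iota>: "is_cocone K M D m \<iota>"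
    and full: "\<And>i j a. i \<in> Obj J \<Longrightarrow> j \<in> Obj J \<Longrightarrow> a \<in> hom K (ob I i) (ob I j) \<Longrightarrow>
      \<exists>b \<in> hom J i j. ar I b = a"
    and eso: "\<And>k. k \<in> Obj K \<Longrightarrow> \<exists>j \<in> Obj J. \<exists>e \<in> hom K k (ob I j). is_iso K e"
  shows "is_colimit K M D m \<iota> \<longleftrightarrow> is_colimit J M (D \<circ>\<^sub>F I) m (\<lambda>j. \<iota> (ob I j))"
proof -
  have D: "is_functor K M D" and m: "m \<in> Obj M"
    using \<iota> by (auto simp: is_cocone_def)
  note M = functor_category(2)[OF D] and K = functor_category(1)[OF D]
  define u where "u k = (SOME j. j \<in> Obj J \<and> (\<exists>e \<in> hom K k (ob I j). is_iso K e))" for k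
  define e where "e k = (SOME e. e \<in> hom K k (ob I (u k)) \<and> is_iso K e)" for k
  have u: "u k \<in> Obj J" "\<exists>e. e \<in> hom K k (ob I (u k)) \<and> is_iso K e" if "k \<in> Obj K" for k
    using someI_ex[of "\<lambda>j. j \<in> Obj J \<and> (\<exists>e \<in> hom K k (ob I j). is_iso K e)"] eso[OF that]
    unfolding u_def by blast+
  have e: "e k \<in> hom K k (ob I (u k))" "is_iso K (e k)" if "k \<in> Obj K" for k
    using someI_ex[OF u(2)[OF that]] unfolding e_def by auto
  \<comment> \<open>In any cocone the leg at \<open>k\<close> is the leg at \<open>I (u k)\<close>
    composed with \<open>D (e k)\<close>. So a candidate \<open>t\<close> is tested on the image of
    \<open>I\<close> alone.\<close>
  have legs: "(\<forall>k \<in> Obj K. Cmp M t (\<iota> k) = \<kappa> k) \<longleftrightarrow>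
      (\<forall>j \<in> Obj J. Cmp M t (\<iota> (ob I j)) = \<kappa> (ob I j))"
    if \<kappa>: "is_cocone K M D n \<kappa>" and t: "t \<in> hom M m n" for n \<kappa> t
  proof safe
    fix j assume "\<forall>k \<in> Obj K. Cmp M t (\<iota> k) = \<kappa> k" "j \<in> Obj J"
    then show "Cmp M t (\<iota> (ob I j)) = \<kappa> (ob I j)"
      using functor_Obj[OF I] by simp
  next
    fix k assume *: "\<forall>j \<in> Obj J. Cmp M t (\<iota> (ob I j)) = \<kappa> (ob I j)" and k: "k \<in> Obj K"
    have Iu: "ob I (u k) \<in> Obj K"
      using functor_Obj[OF I u(1)[OF k]] .
    have "Cmp M t (\<iota> k) = Cmp M t (Cmp M (\<iota> (ob I (u k))) (ar D (e k)))"
      using is_cocone_Cmp[OF \<iota> e(1)[OF k]] by simp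
    also have "\<dots> = Cmp M (Cmp M t (\<iota> (ob I (u k)))) (ar D (e k))"
      by (rule category.Cmp_assoc[OF M functor_hom[OF D e(1)[OF k]] is_cocone_leg[OF \<iota> Iu] t])
    also have "\<dots> = \<kappa> k"
      using * u(1)[OF k] is_cocone_Cmp[OF \<kappa> e(1)[OF k]] by simp
    finally show "Cmp M t (\<iota> k) = \<kappa> k" .
  qed
  have ext: "\<exists>\<kappa>'. is_cocone K M D n \<kappa>' \<and> (\<forall>j \<in> Obj J. \<kappa>' (ob I j) = \<kappa> j)"
    if \<kappa>: "is_cocone J M (D \<circ>\<^sub>F I) n \<kappa>" for n \<kappa>
  proof -
    define \<kappa>' where "\<kappa>' k = Cmp M (\<kappa> (u k)) (ar D (e k))" for k
    have leg: "\<kappa> j \<in> hom M (ob D (ob I j)) n" if "j \<in> Obj J" for j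
      using is_cocone_leg[OF \<kappa> that] by simp
    have shift: "Cmp M (\<kappa> j) (ar D a) = \<kappa> i"
      if ij: "i \<in> Obj J" "j \<in> Obj J" "a \<in> hom K (ob I i) (ob I j)" for i j a
    proof -
      obtain b where "b \<in> hom J i j" "ar I b = a"
        using full[OF ij] by blast
      then show ?thesis
        using is_cocone_Cmp[OF \<kappa>, of b i j] by simp
    qed
    have "is_cocone K M D n \<kappa>'"
    proof (rule is_coconeI[OF D])
      show "n \<in> Obj M"
        using \<kappa> by (simp add: is_cocone_def)
      show "\<kappa>' k \<in> hom M (ob D k) n" if "k \<in> Obj K" for k
        unfolding \<kappa>'_def
        by (rule category.Cmp_hom[OF M functor_hom[OF D e(1)[OF that]] leg[OF u(1)[OF that]]])
      fix a k k' assume a: "a \<in> hom K k k'"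
      have k: "k \<in> Obj K" "k' \<in> Obj K"
        using hom_Obj[OF K a] by auto
      obtain d where d: "d \<in> hom K (ob I (u k)) k" "Cmp K d (e k) = Id K k"
        using e[OF k(1)] by (auto simp: is_iso_def hom_def)
      \<comment> \<open>Conjugating \<open>a\<close> by the chosen isomorphisms gives an arrow
        between objects in the image of \<open>I\<close>, where \<open>shift\<close>
        applies.\<close>
      define b where "b = Cmp K (Cmp K (e k') a) d"
      have e'a: "Cmp K (e k') a \<in> hom K k (ob I (u k'))"
        using category.Cmp_hom[OF K a e(1)[OF k(2)]] .
      have b: "b \<in> hom K (ob I (u k)) (ob I (u k'))"
        unfolding b_def using category.Cmp_hom[OF K d(1) e'a] .
      have "Cmp K b (e k) = Cmp K (e k') a"
        unfolding b_def
        using category.Cmp_assoc[OF K e(1)[OF k(1)] d(1) e'a] d(2) category.Id_right[OF K e'a]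
        by simp
      then have *: "Cmp M (ar D b) (ar D (e k)) = Cmp M (ar D (e k')) (ar D a)"
        using functor_Cmp[OF D e(1)[OF k(1)] b] functor_Cmp[OF D a e(1)[OF k(2)]] by simp
      have "Cmp M (\<kappa>' k') (ar D a) = Cmp M (\<kappa> (u k')) (Cmp M (ar D (e k')) (ar D a))"
        unfolding \<kappa>'_def
        by (rule category.Cmp_assoc[OF M functor_hom[OF D a] functor_hom[OF D e(1)[OF k(2)]]
              leg[OF u(1)[OF k(2)]], symmetric])
      also have "\<dots> = Cmp M (Cmp M (\<kappa> (u k')) (ar D b)) (ar D (e k))"
        unfolding *[symmetric]
        by (rule category.Cmp_assoc[OF M functor_hom[OF D e(1)[OF k(1)]] functor_hom[OF D b]
              leg[OF u(1)[OF k(2)]]])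
      also have "\<dots> = \<kappa>' k"
        using shift[OF u(1)[OF k(1)] u(1)[OF k(2)] b] by (simp add: \<kappa>'_def)
      finally show "Cmp M (\<kappa>' k') (ar D a) = \<kappa>' k" .
    qed
    \<comment> \<open>The object chosen for \<open>I j\<close> may differ from \<open>j\<close>, and
      \<open>e (I j)\<close> need not be an identity. It does run between two objects in the image
      of \<open>I\<close>, so fullness, through \<open>shift\<close>, makes the extension agree with
      \<open>\<kappa>\<close> again.\<close>
    moreover have "\<kappa>' (ob I j) = \<kappa> j" if "j \<in> Obj J" for j
      unfolding \<kappa>'_def
      using functor_Obj[OF I that] by (intro shift u(1) e(1) that)
    ultimately show ?thesis
      by blast
  qed
  have "(\<forall>n \<kappa>. is_cocone K M D n \<kappa> \<longrightarrow>
          (\<exists>!t. t \<in> hom M m n \<and> (\<forall>k \<in> Obj K. Cmp M t (\<iota> k) = \<kappa> k))) \<longleftrightarrow>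
        (\<forall>n \<kappa>. is_cocone J M (D \<circ>\<^sub>F I) n \<kappa> \<longrightarrow>
          (\<exists>!t. t \<in> hom M m n \<and> (\<forall>j \<in> Obj J. Cmp M t (\<iota> (ob I j)) = \<kappa> j)))"
    (is "?L \<longleftrightarrow> ?R")
  proof
    assume L: ?L
    show ?R
    proof (intro allI impI)
      fix n \<kappa> assume "is_cocone J M (D \<circ>\<^sub>F I) n \<kappa>"
      then obtain \<kappa>' where \<kappa>': "is_cocone K M D n \<kappa>'" "\<forall>j \<in> Obj J. \<kappa>' (ob I j) = \<kappa> j"
        using ext by blast
      then have "\<exists>!t. t \<in> hom M m n \<and> (\<forall>k \<in> Obj K. Cmp M t (\<iota> k) = \<kappa>' k)"
        using L by blast
      then show "\<exists>!t. t \<in> hom M m n \<and> (\<forall>j \<in> Obj J. Cmp M t (\<iota> (ob I j)) = \<kappa> j)"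
        using legs[OF \<kappa>'(1)] \<kappa>'(2) by (simp cong: conj_cong)
    qed
  next
    assume R: ?R
    show ?L
    proof (intro allI impI)
      fix n \<kappa> assume \<kappa>: "is_cocone K M D n \<kappa>"
      then have "\<exists>!t. t \<in> hom M m n \<and> (\<forall>j \<in> Obj J. Cmp M t (\<iota> (ob I j)) = \<kappa> (ob I j))"
        using R is_cocone_restrict[OF \<kappa> I] by blast
      then show "\<exists>!t. t \<in> hom M m n \<and> (\<forall>k \<in> Obj K. Cmp M t (\<iota> k) = \<kappa> k)"
        using legs[OF \<kappa>] by (simp cong: conj_cong)
    qed
  qed
  then show ?thesis
    using \<iota> is_cocone_restrict[OF \<iota> I] by (simp add: is_colimit_def)
qed


section \<open>Sequences labelled by an action operad\<close>

lemma ob_seq_map [simp]: "ob (seq_map F) xs = map (ob F) xs"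
  by (simp add: seq_map_def)

text \<open>The operadic substitution enters only through the pseudo algebra axioms, so it is left free.\<close>

locale operad_groups =
  fixes G :: "'g action_operad"
  assumes gone_carrier: "gone G n \<in> gcarrier G n"
    and gmult_carrier: "g \<in> gcarrier G n \<Longrightarrow> h \<in> gcarrier G n \<Longrightarrow> gmult G n h g \<in> gcarrier G n"
    and gone_left: "g \<in> gcarrier G n \<Longrightarrow> gmult G n (gone G n) g = g"
    and gone_right: "g \<in> gcarrier G n \<Longrightarrow> gmult G n g (gone G n) = g"
    and gmult_assoc: "f \<in> gcarrier G n \<Longrightarrow> g \<in> gcarrier G n \<Longrightarrow> h \<in> gcarrier G n \<Longrightarrow>
      gmult G n h (gmult G n g f) = gmult G n (gmult G n h g) f"
    and ginverse: "g \<in> gcarrier G n \<Longrightarrow>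
      \<exists>h \<in> gcarrier G n. gmult G n h g = gone G n \<and> gmult G n g h = gone G n"
    and gperm_permutes: "g \<in> gcarrier G n \<Longrightarrow> gperm G g permutes {..<n}"
    and gperm_gone: "gperm G (gone G n) = id"
    and gperm_gmult: "g \<in> gcarrier G n \<Longrightarrow> h \<in> gcarrier G n \<Longrightarrow>
      gperm G (gmult G n h g) = gperm G h \<circ> gperm G g"
begin

lemma gperm_less: "g \<in> gcarrier G n \<Longrightarrow> i < n \<Longrightarrow> gperm G g i < n"
  using permutes_in_image[OF gperm_permutes, of g n i] by simp

text \<open>\<open>Cod\<close> lists codomains in target order and so reads them through the inverse
  permutation. Since \<open>gperm G g\<close> is a bijection of the positions, this can be restated
  by source position, the form in which composition is defined.\<close>

lemma seq_hom_iff: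
  "(g, fs) \<in> hom (seq_cat G V) xs ys \<longleftrightarrow>
     length fs = length xs \<and> length ys = length xs \<and> g \<in> gcarrier G (length xs) \<and>
     (\<forall>i < length xs. fs ! i \<in> hom V (xs ! i) (ys ! gperm G g i))"
  (is "?L \<longleftrightarrow> ?R")
proof
  assume L: ?L
  then have g: "g \<in> gcarrier G (length fs)" and fs: "set fs \<subseteq> Arr V"
    and xs: "xs = map (Dom V) fs"
    and ys: "ys = map (\<lambda>j. Cod V (fs ! inv (gperm G g) j)) [0..<length fs]"
    by (auto simp: seq_cat_def hom_def)
  have "fs ! i \<in> hom V (xs ! i) (ys ! gperm G g i)" if "i < length fs" for i
    using that fs gperm_less[OF g that] permutes_inverses(2)[OF gperm_permutes[OF g], of i]
    by (auto simp: xs ys hom_def)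
  then show ?R
    using g by (simp add: xs ys)
next
  assume R: ?R
  then have g: "g \<in> gcarrier G (length fs)" and fs: "\<forall>f \<in> set fs. f \<in> Arr V"
    by (auto simp: hom_def in_set_conv_nth)
  have xs: "map (Dom V) fs = xs"
    using R by (intro nth_equalityI) (auto simp: hom_def)
  have "map (\<lambda>j. Cod V (fs ! inv (gperm G g) j)) [0..<length fs] = ys"
  proof (rule nth_equalityI)
    fix j assume "j < length (map (\<lambda>j. Cod V (fs ! inv (gperm G g) j)) [0..<length fs])"
    then have j: "j < length fs"
      by simp
    note p = gperm_permutes[OF g]
    have i: "inv (gperm G g) j < length fs"
      using permutes_in_image[OF permutes_inv[OF p], of j] j by simp
    then have "fs ! inv (gperm G g) j
        \<in> hom V (xs ! inv (gperm G g) j) (ys ! gperm G g (inv (gperm G g) j))"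
      using R by auto
    then show "map (\<lambda>j. Cod V (fs ! inv (gperm G g) j)) [0..<length fs] ! j = ys ! j"
      using j permutes_inverses(1)[OF p, of j] by (auto simp: hom_def)
  qed (use R in auto)
  then show ?L
    using g fs xs by (auto simp: seq_cat_def hom_def)
qed

lemma seq_Obj [simp]: "Obj (seq_cat G V) = lists (Obj V)"
  by (simp add: seq_cat_def)

lemma seq_Id [simp]: "Id (seq_cat G V) xs = (gone G (length xs), map (Id V) xs)"
  by (simp add: seq_cat_def)

lemma seq_Cmp [simp]: "Cmp (seq_cat G V) (h, gs) (g, fs) =
    (gmult G (length fs) h g, map (\<lambda>i. Cmp V (gs ! gperm G g i) (fs ! i)) [0..<length fs])"
  by (simp add: seq_cat_def)

lemma category_seq_cat:
  assumes V: "category V"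
  shows "category (seq_cat G V)"
proof
  let ?S = "seq_cat G V"
  have endpoints: "xs \<in> Obj ?S \<and> ys \<in> Obj ?S" if "a \<in> hom ?S xs ys" for a xs ys
  proof -
    obtain g fs where "a = (g, fs)"
      by (cases a)
    then have h: "length ys = length xs" "g \<in> gcarrier G (length xs)"
        "\<forall>i < length xs. fs ! i \<in> hom V (xs ! i) (ys ! gperm G g i)"
      using that by (auto simp: seq_hom_iff)
    \<comment> \<open>Every target position is hit, namely from the source position
      \<open>inv (gperm G g) j\<close>.\<close>
    have "ys ! j \<in> Obj V" if "j < length xs" for j
    proof -
      note p = gperm_permutes[OF h(2)]
      have "inv (gperm G g) j < length xs"
        using permutes_in_image[OF permutes_inv[OF p], of j] that by simp
      then show ?thesis
        using h(3) hom_Obj(2)[OF V] permutes_inverses(1)[OF p, of j] by metis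
    qed
    moreover have "xs ! i \<in> Obj V" if "i < length xs" for i
      using h(3) that hom_Obj(1)[OF V] by blast
    ultimately show ?thesis
      using h(1) by (auto simp: in_set_conv_nth)
  qed
  show "Dom ?S a \<in> Obj ?S" "Cod ?S a \<in> Obj ?S" if "a \<in> Arr ?S" for a
    using endpoints[of a "Dom ?S a" "Cod ?S a"] that by (auto simp: hom_def)
  show "Id ?S xs \<in> hom ?S xs xs" if "xs \<in> Obj ?S" for xs
    using that category.Id_hom[OF V]
    by (auto simp: seq_hom_iff gone_carrier gperm_gone)
  show "Cmp ?S b a \<in> hom ?S xs zs" if "a \<in> hom ?S xs ys" "b \<in> hom ?S ys zs" for a b xs ys zs
  proof (cases a; cases b)
    fix g fs h gs assume ab: "a = (g, fs)" "b = (h, gs)"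
    show ?thesis
      using that gperm_less
        category.Cmp_hom[OF V, of "fs ! i" "xs ! i" "ys ! gperm G g i" "gs ! gperm G g i"
          "zs ! gperm G h (gperm G g i)" for i]
      by (auto simp: ab seq_hom_iff gmult_carrier gperm_gmult)
  qed
  show "Cmp ?S (Id ?S ys) a = a" if "a \<in> hom ?S xs ys" for a xs ys
  proof (cases a)
    case (Pair g fs)
    then show ?thesis
      using that gperm_less category.Id_left[OF V]
      by (auto simp: seq_hom_iff gone_left intro!: nth_equalityI)
  qed
  show "Cmp ?S a (Id ?S xs) = a" if "a \<in> hom ?S xs ys" for a xs ys
  proof (cases a)
    case (Pair g fs)
    then show ?thesis
      using that category.Id_right[OF V]
      by (auto simp: seq_hom_iff gone_right gperm_gone intro!: nth_equalityI)
  qed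
  show "Cmp ?S c (Cmp ?S b a) = Cmp ?S (Cmp ?S c b) a"
    if "a \<in> hom ?S ws xs" "b \<in> hom ?S xs ys" "c \<in> hom ?S ys zs" for a b c ws xs ys zs
  proof (cases a; cases b; cases c)
    fix g fs h gs k hs assume abc: "a = (g, fs)" "b = (h, gs)" "c = (k, hs)"
    show ?thesis
      using that gperm_less
        category.Cmp_assoc[OF V, of "fs ! i" "ws ! i" "xs ! gperm G g i" "gs ! gperm G g i"
          "ys ! gperm G h (gperm G g i)" "hs ! gperm G h (gperm G g i)"
          "zs ! gperm G k (gperm G h (gperm G g i))" for i]
      by (auto simp: abc seq_hom_iff gmult_assoc gperm_gmult)
  qed
qed

lemma is_functor_seq_map:
  assumes F: "is_functor V W F"
  shows "is_functor (seq_cat G V) (seq_cat G W) (seq_map F)"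
proof (rule is_functorI)
  note V = functor_category(1)[OF F] and W = functor_category(2)[OF F]
  show "category (seq_cat G V)" "category (seq_cat G W)"
    using V W category_seq_cat by auto
  show "ob (seq_map F) xs \<in> Obj (seq_cat G W)" if "xs \<in> Obj (seq_cat G V)" for xs
    using that functor_Obj[OF F] by (auto simp: seq_map_def)
  show "ar (seq_map F) (Id (seq_cat G V) xs) = Id (seq_cat G W) (ob (seq_map F) xs)"
    if "xs \<in> Obj (seq_cat G V)" for xs
    using that functor_Id[OF F] by (auto simp: seq_map_def)
  show "ar (seq_map F) a \<in> hom (seq_cat G W) (ob (seq_map F) xs) (ob (seq_map F) ys)"
    if "a \<in> hom (seq_cat G V) xs ys" for a xs ys
    using that functor_hom[OF F] gperm_less by (cases a) (auto simp: seq_map_def seq_hom_iff)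
  show "ar (seq_map F) (Cmp (seq_cat G V) b a) =
      Cmp (seq_cat G W) (ar (seq_map F) b) (ar (seq_map F) a)"
    if "a \<in> hom (seq_cat G V) xs ys" "b \<in> hom (seq_cat G V) ys zs" for a b xs ys zs
  proof (cases a; cases b)
    fix g fs h gs assume ab: "a = (g, fs)" "b = (h, gs)"
    show ?thesis
      using that gperm_less
        functor_Cmp[OF F, of "fs ! i" "xs ! i" "ys ! gperm G g i" "gs ! gperm G g i"
          "zs ! gperm G h (gperm G g i)" for i]
      by (auto simp: ab seq_map_def seq_hom_iff)
  qed
qed

text \<open>The inverse carries the inverse group element and identities on the permuted sequence.
  With \<open>is_iso_comma\<close> it yields the isomorphisms needed for essential
  surjectivity.\<close>

lemma is_iso_seq_relabel:
  assumes V: "category V" and g: "g \<in> gcarrier G (length xs)" and xs: "xs \<in> lists (Obj V)"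
  shows "is_iso (seq_cat G V) (g, map (Id V) xs)"
proof -
  let ?S = "seq_cat G V" and ?p = "gperm G g"
  define ys where "ys = map (\<lambda>j. xs ! inv ?p j) [0..<length xs]"
  obtain h where h: "h \<in> gcarrier G (length xs)" "gmult G (length xs) h g = gone G (length xs)"
      "gmult G (length xs) g h = gone G (length xs)"
    using ginverse[OF g] by blast
  note p = gperm_permutes[OF g]
  have hp: "gperm G h \<circ> ?p = id" "?p \<circ> gperm G h = id"
    using gperm_gmult[OF g h(1)] gperm_gmult[OF h(1) g] h gperm_gone by auto
  \<comment> \<open>The target \<open>ys\<close> is written with the inverse function of
    \<open>?p\<close>, whereas composition uses the permutation of the group inverse
    \<open>h\<close>; the homomorphism property identifies the two.\<close>
  have h_inv: "gperm G h j = inv ?p j" for j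
    using hp(1) permutes_inverses(1)[OF p, of j] by (metis comp_apply id_apply)
  have ph: "?p (gperm G h j) = j" and hp': "gperm G h (?p j) = j" for j
    using hp by (metis comp_apply id_apply)+
  have ys_nth: "ys ! j = xs ! gperm G h j" if "j < length xs" for j
    using that by (simp add: ys_def h_inv)
  have xs_in: "xs ! i \<in> Obj V" if "i < length xs" for i
    using xs that by auto
  have a: "(g, map (Id V) xs) \<in> hom ?S xs ys"
    using g gperm_less[OF g] category.Id_hom[OF V] xs_in
    by (auto simp: seq_hom_iff ys_nth hp') (simp add: ys_def)
  have b: "(h, map (Id V) ys) \<in> hom ?S ys xs"
    using h gperm_less[OF h(1)] category.Id_hom[OF V] xs_in
    by (auto simp: seq_hom_iff ys_def h_inv)
  have len: "length ys = length xs"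
    by (simp add: ys_def)
  have Id_Id: "Cmp V (Id V x) (Id V x) = Id V x" if "x \<in> Obj V" for x
    using category.Id_left[OF V category.Id_hom[OF V that]] .
  have "Cmp ?S (h, map (Id V) ys) (g, map (Id V) xs) = Id ?S xs"
    using gperm_less[OF g] h xs_in
    by (auto simp: len ys_nth hp' Id_Id intro!: nth_equalityI)
  moreover have "Cmp ?S (g, map (Id V) xs) (h, map (Id V) ys) = Id ?S ys"
    using gperm_less[OF h(1)] h xs_in
    by (auto simp: len ys_nth Id_Id intro!: nth_equalityI)
  ultimately show ?thesis
    using is_isoI[OF a b] by simp
qed

end


text \<open>The monoidal case is the instance with one-element groups, so the general facts on
  sequence categories serve both sides of the comparison.\<close>

interpretation trivial: operad_groups trivial_operad
  by unfold_locales (auto simp: trivial_operad_def)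

lemma trivial_gperm [simp]: "gperm trivial_operad g = id"
  by (simp add: trivial_operad_def)

lemma trivial_seq_hom_iff:
  "(g, fs) \<in> hom (seq_cat trivial_operad V) xs ys \<longleftrightarrow>
     length fs = length xs \<and> length ys = length xs \<and>
     (\<forall>i < length xs. fs ! i \<in> hom V (xs ! i) (ys ! i))"
  by (simp add: trivial.seq_hom_iff) (simp add: trivial_operad_def)

section \<open>The inclusion of unlabelled into labelled comma categories\<close>

context operad_groups
begin

text \<open>The arrow part of \<open>seq_incl G\<close>, named separately because in a comma
  category it acts both on arrows between sequences in \<open>V\<close> and on structure maps in
  \<open>W\<close>.\<close>

definition label :: "unit \<times> 'b list \<Rightarrow> 'g \<times> 'b list" where
  "label a = (gone G (length (snd a)), snd a)"

lemma seq_incl_label [simp]: "ob (seq_incl G) xs = xs" "ar (seq_incl G) a = label a"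
  by (auto simp: seq_incl_def label_def split: prod.split)

text \<open>The unit label permutes nothing, so the components keep their types. The direction from
  left to right is what later pulls a labelled comma arrow back to an unlabelled one.\<close>

lemma label_hom_iff:
  "label a \<in> hom (seq_cat G V) xs ys \<longleftrightarrow> a \<in> hom (seq_cat trivial_operad V) xs ys"
  by (cases a)
    (auto simp: label_def seq_hom_iff trivial_seq_hom_iff gperm_gone gone_carrier)

lemma is_functor_seq_incl:
  assumes V: "category V"
  shows "is_functor (seq_cat trivial_operad V) (seq_cat G V) (seq_incl G)"
proof (rule is_functorI)
  show "category (seq_cat trivial_operad V)" "category (seq_cat G V)"
    using V trivial.category_seq_cat category_seq_cat by auto
  show "ar (seq_incl G) a \<in> hom (seq_cat G V) (ob (seq_incl G) xs) (ob (seq_incl G) ys)"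
    if "a \<in> hom (seq_cat trivial_operad V) xs ys" for a xs ys
    using iffD2[OF label_hom_iff that] by simp
  show "ar (seq_incl G) (Cmp (seq_cat trivial_operad V) b a) =
      Cmp (seq_cat G V) (ar (seq_incl G) b) (ar (seq_incl G) a)"
    if "a \<in> hom (seq_cat trivial_operad V) xs ys" "b \<in> hom (seq_cat trivial_operad V) ys zs"
    for a b xs ys zs
  proof (cases a; cases b)
    fix g fs h gs assume ab: "a = (g, fs)" "b = (h, gs)"
    show ?thesis
      using that gone_left[OF gone_carrier]
      by (auto simp: ab label_def trivial_seq_hom_iff gperm_gone)
  qed
qed (auto simp: label_def)

text \<open>The functor induced on comma categories by \<open>seq_incl G\<close> on both sides. It
  stays over the same \<open>ys\<close> because \<open>seq_incl G\<close> is the identity on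
  objects, and it respects triangles because \<open>seq_map F\<close> commutes with
  labelling.\<close>

definition comma_incl :: "('o list \<times> unit \<times> 'b list,
    ('o list \<times> unit \<times> 'b list) \<times> (unit \<times> 'a list) \<times> 'o list \<times> unit \<times> 'b list,
    'o list \<times> 'g \<times> 'b list,
    ('o list \<times> 'g \<times> 'b list) \<times> ('g \<times> 'a list) \<times> 'o list \<times> 'g \<times> 'b list) fun_data" where
  "comma_incl =
     \<lparr>ob = (\<lambda>(x, u). (x, label u)),
      ar = (\<lambda>((x, u), v, (y, w)).
        ((x, label u), label v, (y, label w)))\<rparr>"

lemma ob_comma_incl: "ob comma_incl s = (fst s, label (snd s))"
  by (simp add: comma_incl_def split_def)

lemma seq_map_label: "ar (seq_map F) (label a) = label (ar (seq_map F) a)"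
  by (cases a) (simp add: seq_map_def label_def)

lemma label_inject: "label a = label b \<longleftrightarrow> a = (b :: unit \<times> 'b list)"
  by (cases a; cases b) (auto simp: label_def)

lemma comma_incl_Obj_iff:
  "ob comma_incl s \<in> Obj (comma (seq_cat G V) (seq_cat G W) (seq_map F) ys) \<longleftrightarrow>
    s \<in> Obj (comma (seq_cat trivial_operad V) (seq_cat trivial_operad W) (seq_map F) ys)"
  by (cases s) (auto simp: comma_incl_def label_hom_iff)

lemma comma_incl_hom_iff:
  assumes W: "category W" and F: "is_functor V W F"
  shows "ar comma_incl a \<in> hom (comma (seq_cat G V) (seq_cat G W) (seq_map F) ys)
      (ob comma_incl s) (ob comma_incl t) \<longleftrightarrow>
    a \<in> hom (comma (seq_cat trivial_operad V) (seq_cat trivial_operad W) (seq_map F) ys) s t"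
proof -
  obtain x u v y w where a: "a = ((x, u), v, (y, w))"
    by (metis surj_pair)
  obtain x' u' y' w' where st: "s = (x', u')" "t = (y', w')"
    by (cases s; cases t)
  \<comment> \<open>Functoriality of \<open>seq_incl G\<close> preserves the triangle over
    \<open>ys\<close>; injectivity of \<open>label\<close> reflects it.\<close>
  have "Cmp (seq_cat G W) (label w) (ar (seq_map F) (label v)) =
      label u \<longleftrightarrow> Cmp (seq_cat trivial_operad W) w (ar (seq_map F) v) = u"
    if "v \<in> hom (seq_cat trivial_operad V) x y"
      "w \<in> hom (seq_cat trivial_operad W) (map (ob F) y) ys"
    using functor_Cmp[OF is_functor_seq_incl[OF W]
        functor_hom[OF trivial.is_functor_seq_map[OF F] that(1)], of w ys] that(2)
    by (simp add: seq_map_label label_inject flip: label_inject)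
  then show ?thesis
    by (auto simp: a st comma_incl_def comma_hom_iff label_hom_iff label_inject)
qed

lemma is_functor_comma_incl:
  assumes F: "is_functor V W F"
  shows "is_functor (comma (seq_cat trivial_operad V) (seq_cat trivial_operad W) (seq_map F) ys)
    (comma (seq_cat G V) (seq_cat G W) (seq_map F) ys) comma_incl"
proof (rule is_functorI)
  note V = functor_category(1)[OF F] and W = functor_category(2)[OF F]
  let ?J = "comma (seq_cat trivial_operad V) (seq_cat trivial_operad W) (seq_map F) ys"
  let ?K = "comma (seq_cat G V) (seq_cat G W) (seq_map F) ys"
  show "category ?J" "category ?K"
    by (rule category_comma[OF trivial.is_functor_seq_map[OF F]])
      (rule category_comma[OF is_functor_seq_map[OF F]])
  show "ob comma_incl s \<in> Obj ?K" if "s \<in> Obj ?J" for s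
    using that comma_incl_Obj_iff by blast
  show "ar comma_incl (Id ?J s) = Id ?K (ob comma_incl s)" for s
    by (cases s) (simp add: comma_incl_def label_def)
  show "ar comma_incl a \<in> hom ?K (ob comma_incl s) (ob comma_incl t)" if "a \<in> hom ?J s t" for a s t
    using that comma_incl_hom_iff[OF W F] by blast
  show "ar comma_incl (Cmp ?J b a) = Cmp ?K (ar comma_incl b) (ar comma_incl a)"
    if a: "a \<in> hom ?J r s" and b: "b \<in> hom ?J s t" for a b r s t
  proof -
    obtain v where v: "a = (r, v, s)" "v \<in> hom (seq_cat trivial_operad V) (fst r) (fst s)"
      using a by (rule comma_homE)
    obtain w where w: "b = (s, w, t)" "w \<in> hom (seq_cat trivial_operad V) (fst s) (fst t)"
      using b by (rule comma_homE)
    show ?thesis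
      using functor_Cmp[OF is_functor_seq_incl[OF V] v(2) w(2)]
      by (simp add: v(1) w(1) comma_incl_def split: prod.splits)
  qed
qed

text \<open>A morphism of \<open>G\<close>-labelled sequences over \<open>ys\<close> between unlabelled ones has label \<open>1\<close>.\<close>

lemma comma_incl_full:
  assumes F: "is_functor V W F"
    and st: "s \<in> Obj (comma (seq_cat trivial_operad V) (seq_cat trivial_operad W) (seq_map F) ys)"
      "t \<in> Obj (comma (seq_cat trivial_operad V) (seq_cat trivial_operad W) (seq_map F) ys)"
    and a: "a \<in> hom (comma (seq_cat G V) (seq_cat G W) (seq_map F) ys)
      (ob comma_incl s) (ob comma_incl t)"
  shows "\<exists>b \<in> hom (comma (seq_cat trivial_operad V) (seq_cat trivial_operad W) (seq_map F) ys) s t.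
    ar comma_incl b = a"
proof -
  obtain xs u xs' u' where s: "s = (xs, u)" and t: "t = (xs', u')"
    by (cases s; cases t)
  obtain v where v: "a = (ob comma_incl s, v, ob comma_incl t)" "v \<in> hom (seq_cat G V) xs xs'"
      "Cmp (seq_cat G W) (label u') (ar (seq_map F) v) = label u"
    using a by (rule comma_homE) (simp add: s t comma_incl_def)
  obtain g gs where gs: "v = (g, gs)"
    by (cases v)
  have g: "g \<in> gcarrier G (length xs)" "length gs = length xs" "length xs' = length xs"
    using v(2) by (auto simp: gs seq_hom_iff)
  \<comment> \<open>The unit \<open>gone G n\<close> depends on \<open>n\<close>, and each label
    takes its \<open>n\<close> from its own list. Only after the lengths are matched do the first
    components of the triangle read \<open>1 g = 1\<close> in a single group.\<close>
  have "length (snd u) = length xs" "length (snd u') = length xs'"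
    using st by (cases u; cases u'; auto simp: s t trivial_seq_hom_iff)+
  then have "g = gone G (length xs)"
    using v(3) g gone_left[OF g(1)] by (auto simp: gs seq_map_def label_def)
  then have "v = label ((), gs)"
    using g(2) by (simp add: gs label_def)
  then have "ar comma_incl (s, ((), gs), t) = a"
    by (simp add: v(1) s t comma_incl_def)
  then show ?thesis
    using a comma_incl_hom_iff[OF functor_category(2)[OF F] F] by metis
qed

lemma comma_incl_essentially_surjective:
  assumes F: "is_functor V W F"
    and k: "k \<in> Obj (comma (seq_cat G V) (seq_cat G W) (seq_map F) ys)"
  shows "\<exists>s \<in> Obj (comma (seq_cat trivial_operad V) (seq_cat trivial_operad W) (seq_map F) ys).
    \<exists>e \<in> hom (comma (seq_cat G V) (seq_cat G W) (seq_map F) ys) k (ob comma_incl s).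
      is_iso (comma (seq_cat G V) (seq_cat G W) (seq_map F) ys) e"
proof -
  note V = functor_category(1)[OF F] and W = functor_category(2)[OF F]
  let ?K = "comma (seq_cat G V) (seq_cat G W) (seq_map F) ys"
  obtain xs g fs where k_eq: "k = (xs, g, fs)"
    by (metis surj_pair)
  have xs: "xs \<in> lists (Obj V)" and g: "g \<in> gcarrier G (length xs)"
    and len: "length fs = length xs" "length ys = length xs"
    and fs: "\<And>i. i < length xs \<Longrightarrow> fs ! i \<in> hom W (ob F (xs ! i)) (ys ! gperm G g i)"
    using k by (auto simp: k_eq seq_hom_iff)
  note p = gperm_permutes[OF g]
  have inv_less: "inv (gperm G g) j < length xs" if "j < length xs" for j
    using permutes_in_image[OF permutes_inv[OF p], of j] that by simp
  \<comment> \<open>Each entry moves, together with its arrow, to the position where that arrow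
    ends. Hence position \<open>j\<close> is filled from \<open>inv (gperm G g) j\<close>, and
    \<open>fs' ! j\<close> ends at \<open>ys ! j\<close>.\<close>
  define xs' where "xs' = map (\<lambda>j. xs ! inv (gperm G g) j) [0..<length xs]"
  define fs' where "fs' = map (\<lambda>j. fs ! inv (gperm G g) j) [0..<length xs]"
  let ?s = "(xs', (), fs')"
  have "fs' ! j \<in> hom W (ob F (xs' ! j)) (ys ! j)" if "j < length xs" for j
    using fs[OF inv_less[OF that]] that permutes_inverses(1)[OF p, of j]
    by (simp add: xs'_def fs'_def)
  moreover have "xs' \<in> lists (Obj V)"
    using xs inv_less by (auto simp: xs'_def)
  moreover have "length xs' = length xs" "length fs' = length xs"
    by (auto simp: xs'_def fs'_def)
  ultimately have s: "?s \<in> Obj (comma (seq_cat trivial_operad V) (seq_cat trivial_operad W)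
      (seq_map F) ys)"
    using len by (auto simp: trivial_seq_hom_iff)
  have "(g, map (Id V) xs) \<in> hom (seq_cat G V) xs xs'"
    using g xs gperm_less[OF g] permutes_inverses(2)[OF p] category.Id_hom[OF V]
    by (auto simp: seq_hom_iff xs'_def)
  moreover have "Cmp W (fs ! i) (ar F (Id V (xs ! i))) = fs ! i" if "i < length xs" for i
    using xs that functor_Id[OF F, of "xs ! i"] category.Id_right[OF W fs[OF that]] by auto
  \<comment> \<open>\<open>(g, fs)\<close> factors as the relabelling followed by the unlabelled
    family: the labels give \<open>1 g = g\<close>, and component \<open>i\<close> is
    \<open>fs' ! gperm G g i\<close>, that is \<open>fs ! i\<close>, after an identity.\<close>
  then have "Cmp (seq_cat G W) (label ((), fs')) (ar (seq_map F) (g, map (Id V) xs)) = (g, fs)"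
    using gone_left[OF g] gperm_less[OF g] permutes_inverses(2)[OF p] len
    by (auto simp: label_def seq_map_def fs'_def intro!: nth_equalityI)
  ultimately have e: "(k, (g, map (Id V) xs), ob comma_incl ?s) \<in> hom ?K k (ob comma_incl ?s)"
    using k iffD2[OF comma_incl_Obj_iff s] by (simp add: comma_hom_iff) (simp add: k_eq comma_incl_def)
  have "is_iso ?K (k, (g, map (Id V) xs), ob comma_incl ?s)"
    by (rule is_iso_comma[OF is_functor_seq_map[OF F] e is_iso_seq_relabel[OF V g xs]])
  then show ?thesis
    using s e by blast
qed

section \<open>Transfer of Kan extensions and of exactness\<close>

lemma seq_map_incl: "seq_map F \<circ>\<^sub>F seq_incl G = seq_incl G \<circ>\<^sub>F seq_map F"
  by (auto simp: comp_functor_def seq_map_def seq_incl_def fun_eq_iff)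

lemma comma_proj_incl: "comma_proj \<circ>\<^sub>F comma_incl = seq_incl G \<circ>\<^sub>F comma_proj"
  by (auto simp: comp_functor_def comma_proj_def comma_incl_def fun_eq_iff)

text \<open>Pulled back along \<open>comma_incl\<close>, the diagram and the legs become those of
  the data restricted along \<open>seq_incl G\<close>: objects stay fixed, and \<open>l\<close> sees
  the labelled arrow. So \<open>is_colimit_restrict\<close> compares exactly these two
  colimits.\<close>

lemma is_colimit_comma_incl:
  assumes F: "is_functor V W F" and l: "is_functor (seq_cat G W) M l"
    and \<psi>: "is_natural (seq_cat G V) M h (l \<circ>\<^sub>F seq_map F) \<psi>"
    and ys: "ys \<in> lists (Obj W)"
  shows "is_colimit (comma (seq_cat G V) (seq_cat G W) (seq_map F) ys) M (h \<circ>\<^sub>F comma_proj)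
      (ob l ys) (\<lambda>(x, u). Cmp M (ar l u) (\<psi> x)) \<longleftrightarrow>
    is_colimit (comma (seq_cat trivial_operad V) (seq_cat trivial_operad W) (seq_map F) ys) M
      ((h \<circ>\<^sub>F seq_incl G) \<circ>\<^sub>F comma_proj) (ob (l \<circ>\<^sub>F seq_incl G) ys)
      (\<lambda>(x, u). Cmp M (ar (l \<circ>\<^sub>F seq_incl G) u) (\<psi> x))"
proof -
  have cocone: "is_cocone (comma (seq_cat G V) (seq_cat G W) (seq_map F) ys) M
      (h \<circ>\<^sub>F comma_proj) (ob l ys) (\<lambda>(x, u). Cmp M (ar l u) (\<psi> x))"
    using is_cocone_comma[OF \<psi> is_functor_seq_map[OF F] l] ys by simp
  show ?thesis
    using is_colimit_restrict[OF is_functor_comma_incl[OF F] cocone comma_incl_full[OF F]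
        comma_incl_essentially_surjective[OF F]]
    by (simp add: ob_comma_incl split_def comp_functor_assoc comma_proj_incl)
qed

text \<open>Labelled and unlabelled sequences have the same objects, so both conditions run over the
  same \<open>ys\<close>, with the same family \<open>\<psi>\<close>, and can be compared one
  \<open>ys\<close> at a time.\<close>

lemma pointwise_left_kan_seq_incl:
  assumes F: "is_functor V W F" and l: "is_functor (seq_cat G W) M l"
    and \<psi>: "is_natural (seq_cat G V) M h (l \<circ>\<^sub>F seq_map F) \<psi>"
  shows "pointwise_left_kan (seq_cat G V) (seq_cat G W) M (seq_map F) h l \<psi> \<longleftrightarrow>
    pointwise_left_kan (seq_cat trivial_operad V) (seq_cat trivial_operad W) M (seq_map F)
      (h \<circ>\<^sub>F seq_incl G) (l \<circ>\<^sub>F seq_incl G) \<psi>"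
proof -
  note V = functor_category(1)[OF F] and W = functor_category(2)[OF F]
  have "is_natural (seq_cat trivial_operad V) M (h \<circ>\<^sub>F seq_incl G)
      ((l \<circ>\<^sub>F seq_incl G) \<circ>\<^sub>F seq_map F) \<psi>"
    using is_natural_whisker_right[OF \<psi> is_functor_seq_incl[OF V]]
    by (simp add: comp_functor_assoc seq_map_incl)
  moreover from this have "is_functor (seq_cat trivial_operad V) M (h \<circ>\<^sub>F seq_incl G)"
    by (rule natural_functor)
  ultimately show ?thesis
    using is_colimit_comma_incl[OF F l \<psi>] l \<psi> natural_functor(1)[OF \<psi>]
      is_functor_comp[OF is_functor_seq_incl[OF W] l]
      is_functor_seq_map[OF F] trivial.is_functor_seq_map[OF F]
    by (simp add: pointwise_left_kan_def)
qed

text \<open>The premise of exactness is a Kan extension along \<open>F\<close> itself and mentions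
  no sequences. Both conditions thus range over the same \<open>M\<close>, \<open>h\<close>,
  \<open>l\<close>, \<open>\<psi>\<close>, and only their conclusions have to be matched.\<close>

theorem exact_colax_morphism_underlying:
  fixes T :: "('m, 'n) precat itself"
  assumes colax: "colax_morphism G A B F \<Phi>"
  shows "exact_colax_morphism T G A B F \<Phi> \<longleftrightarrow>
    exact_colax_morphism T trivial_operad
      (underlying_monoidal G A) (underlying_monoidal G B) F \<Phi>"
proof -
  define V where "V = carr A"
  define W where "W = carr B"
  have F: "is_functor V W F" and A: "is_functor (seq_cat G V) V (tens A)"
    and B: "is_functor (seq_cat G W) W (tens B)"
    and \<Phi>: "is_natural (seq_cat G V) W (F \<circ>\<^sub>F tens A) (tens B \<circ>\<^sub>F seq_map F) \<Phi>"
    using colax by (auto simp: colax_morphism_def pseudo_algebra_def Let_def V_def W_def)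
  note V = functor_category(1)[OF F] and W = functor_category(2)[OF F]
  have lax: "lax_square (seq_cat G V) V (seq_cat G W) W (tens A) (seq_map F) F (tens B) \<Phi>"
    using F A B \<Phi> is_functor_seq_map[OF F] by (simp add: lax_square_def)
  have "is_natural (seq_cat trivial_operad V) W (F \<circ>\<^sub>F (tens A \<circ>\<^sub>F seq_incl G))
      ((tens B \<circ>\<^sub>F seq_incl G) \<circ>\<^sub>F seq_map F) \<Phi>"
    using is_natural_whisker_right[OF \<Phi> is_functor_seq_incl[OF V]]
    by (simp add: comp_functor_assoc seq_map_incl)
  then have lax': "lax_square (seq_cat trivial_operad V) V (seq_cat trivial_operad W) W
      (tens A \<circ>\<^sub>F seq_incl G) (seq_map F) F (tens B \<circ>\<^sub>F seq_incl G) \<Phi>"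
    using F trivial.is_functor_seq_map[OF F] is_functor_comp[OF is_functor_seq_incl[OF V] A]
      is_functor_comp[OF is_functor_seq_incl[OF W] B] by (simp add: lax_square_def)
  have kan: "pointwise_left_kan (seq_cat G V) (seq_cat G W) M (seq_map F)
        (h \<circ>\<^sub>F tens A) (l \<circ>\<^sub>F tens B) (\<lambda>xs. Cmp M (ar l (\<Phi> xs)) (\<psi> (ob (tens A) xs))) \<longleftrightarrow>
      pointwise_left_kan (seq_cat trivial_operad V) (seq_cat trivial_operad W) M (seq_map F)
        (h \<circ>\<^sub>F tens A \<circ>\<^sub>F seq_incl G) (l \<circ>\<^sub>F tens B \<circ>\<^sub>F seq_incl G)
        (\<lambda>xs. Cmp M (ar l (\<Phi> xs)) (\<psi> (ob (tens A \<circ>\<^sub>F seq_incl G) xs)))"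
    if "pointwise_left_kan V W M F h l \<psi>" for M :: "('m, 'n) precat" and h l \<psi>
  proof -
    have l: "is_functor W M l" and \<psi>: "is_natural V M h (l \<circ>\<^sub>F F) \<psi>"
      using that by (auto simp: pointwise_left_kan_def)
    \<comment> \<open>The pasted 2-cell is \<open>\<psi>\<close> whiskered with the tensor product
      of \<open>A\<close>, followed by \<open>\<Phi>\<close> whiskered with
      \<open>l\<close>.\<close>
    have "is_natural (seq_cat G V) M (h \<circ>\<^sub>F tens A) ((l \<circ>\<^sub>F tens B) \<circ>\<^sub>F seq_map F)
        (\<lambda>xs. Cmp M (ar l (\<Phi> xs)) (\<psi> (ob (tens A) xs)))"
      using is_natural_vertical[OF is_natural_whisker_right[OF \<psi> A]] is_natural_whisker_left[OF \<Phi> l]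
      by (simp add: comp_functor_assoc)
    from pointwise_left_kan_seq_incl[OF F is_functor_comp[OF B l] this]
    show ?thesis
      by (simp add: comp_functor_assoc)
  qed
  show ?thesis
    using lax lax' kan
    unfolding exact_colax_morphism_def exact_square_def underlying_monoidal_def V_def W_def
    by auto
qed

end


section \<open>Symmetric groups and braid groups\<close>

interpretation symmetric: operad_groups symmetric_operad
proof
  show "\<exists>h \<in> gcarrier symmetric_operad n. gmult symmetric_operad n h g = gone symmetric_operad n \<and>
      gmult symmetric_operad n g h = gone symmetric_operad n"
    if "g \<in> gcarrier symmetric_operad n" for g n
    using that permutes_inv[of g] permutes_inv_o[of g]
    by (intro bexI[of _ "inv g"]) (auto simp: symmetric_operad_def)
qed (auto simp: symmetric_operad_def permutes_id permutes_compose o_assoc)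

section \<open>Braid groups as words modulo the Artin relations\<close>

lemma braid_words_append [simp]:
  "u @ v \<in> braid_words n \<longleftrightarrow> u \<in> braid_words n \<and> v \<in> braid_words n"
  by (auto simp: braid_words_def)

lemma Nil_braid_words [simp]: "[] \<in> braid_words n"
  by (simp add: braid_words_def)

lemma Cons_braid_words [simp]:
  "(e, i) # w \<in> braid_words n \<longleftrightarrow> Suc i < n \<and> w \<in> braid_words n"
  by (auto simp: braid_words_def)

abbreviation braid_equiv :: "nat \<Rightarrow> braid_word \<Rightarrow> braid_word \<Rightarrow> bool" where
  "braid_equiv n \<equiv> equivclp (artin_step n)"

lemma artin_step_context:
  assumes "artin_step n u v" "s \<in> braid_words n" "t \<in> braid_words n"
  shows "artin_step n (s @ u @ t) (s @ v @ t)"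
proof -
  obtain s' t' r r' where "artin_relation r r'" "u = s' @ r @ t'" "v = s' @ r' @ t'"
    using assms(1) by (auto simp: artin_step_def)
  then have "\<exists>s'' t'' r r'. artin_relation r r' \<and> s @ u @ t = s'' @ r @ t'' \<and>
      s @ v @ t = s'' @ r' @ t''"
    by (intro exI[of _ "s @ s'"] exI[of _ "t' @ t"] exI[of _ r] exI[of _ r']) simp
  then show ?thesis
    using assms unfolding artin_step_def by simp
qed

lemma braid_equiv_context:
  assumes "braid_equiv n u v" "s \<in> braid_words n" "t \<in> braid_words n"
  shows "braid_equiv n (s @ u @ t) (s @ v @ t)"
  using assms(1)
proof (induction rule: equivclp_induct)
  case (step v w)
  then have "artin_step n (s @ v @ t) (s @ w @ t) \<or> artin_step n (s @ w @ t) (s @ v @ t)"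
    using artin_step_context assms by blast
  then show ?case
    using step.IH by (rule equivclp_into_equivclp[rotated])
qed simp

text \<open>Passes through \<open>u' @ v\<close>, replacing one factor at a time. Hence exactly
  \<open>v\<close> and \<open>u'\<close> serve as contexts and have to be words on \<open>n\<close>
  strands.\<close>

lemma braid_equiv_append:
  assumes "braid_equiv n u u'" "braid_equiv n v v'" "u' \<in> braid_words n" "v \<in> braid_words n"
  shows "braid_equiv n (u @ v) (u' @ v')"
  using braid_equiv_context[OF assms(1), of "[]" v] braid_equiv_context[OF assms(2), of u' "[]"]
    assms(3,4) by (auto intro: equivclp_trans)

lemma braid_class_eq_iff:
  assumes "u \<in> braid_words n" "v \<in> braid_words n"
  shows "braid_class n u = braid_class n v \<longleftrightarrow> braid_equiv n u v"
proof
  assume "braid_class n u = braid_class n v"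
  moreover have "v \<in> braid_class n v"
    using assms by (simp add: braid_class_def)
  ultimately have "v \<in> braid_class n u"
    by simp
  then show "braid_equiv n u v"
    by (simp add: braid_class_def)
next
  assume "braid_equiv n u v"
  then have "braid_equiv n u w \<longleftrightarrow> braid_equiv n v w" for w
    by (meson equivclp_sym equivclp_trans)
  then show "braid_class n u = braid_class n v"
    by (simp add: braid_class_def)
qed

text \<open>The product is a union over all representatives. Concatenation respects equivalence, so
  all members of the union are the same class. The factors swap because words are read in time
  order.\<close>

lemma braid_gmult:
  assumes "u \<in> braid_words n" "v \<in> braid_words n"
  shows "gmult braid_operad n (braid_class n v) (braid_class n u) = braid_class n (u @ v)"
proof -
  have *: "braid_class n (u' @ v') = braid_class n (u @ v)"
    if "u' \<in> braid_class n u" "v' \<in> braid_class n v" for u' v'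
  proof -
    have *: "u' \<in> braid_words n" "v' \<in> braid_words n" "braid_equiv n u u'" "braid_equiv n v v'"
      using that by (auto simp: braid_class_def)
    then have "braid_equiv n (u @ v) (u' @ v')"
      using braid_equiv_append assms by blast
    then have "braid_class n (u @ v) = braid_class n (u' @ v')"
      using * assms by (simp add: braid_class_eq_iff)
    then show ?thesis ..
  qed
  have "u \<in> braid_class n u" "v \<in> braid_class n v"
    using assms by (auto simp: braid_class_def)
  \<comment> \<open>A union of a constant family equals that constant only over a nonempty index
    set.\<close>
  then have ne: "braid_class n u \<noteq> {}" "braid_class n v \<noteq> {}"
    by blast+
  have "(\<Union>u' \<in> braid_class n u. \<Union>v' \<in> braid_class n v. braid_class n (u' @ v')) =
      (\<Union>u' \<in> braid_class n u. \<Union>v' \<in> braid_class n v. braid_class n (u @ v))"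
    by (intro SUP_cong refl *)
  then show ?thesis
    using ne by (simp add: braid_operad_def)
qed

definition braid_inverse :: "braid_word \<Rightarrow> braid_word" where
  "braid_inverse w = rev (map (\<lambda>(e, i). (\<not> e, i)) w)"

lemma braid_inverse_words: "w \<in> braid_words n \<Longrightarrow> braid_inverse w \<in> braid_words n"
  by (auto simp: braid_inverse_def braid_words_def)

lemma braid_inverse_inverse [simp]: "braid_inverse (braid_inverse w) = w"
  by (induction w) (auto simp: braid_inverse_def)

text \<open>The word cancels from the middle outwards. Since \<open>braid_inverse\<close> is an
  involution, applying this to the inverse word gives the inverse law on the other side.\<close>

lemma braid_inverse_right:
  assumes "w \<in> braid_words n"
  shows "braid_equiv n (w @ braid_inverse w) []"
  using assms
proof (induction w)
  case (Cons x w)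
  obtain e i where x: "x = (e, i)"
    by (cases x)
  have w: "w \<in> braid_words n" "Suc i < n"
    using Cons.prems by (auto simp: x)
  have "braid_equiv n ([x] @ (w @ braid_inverse w) @ [(\<not> e, i)]) ([x] @ [] @ [(\<not> e, i)])"
    using w by (intro braid_equiv_context Cons.IH) (auto simp: x)
  moreover have "artin_step n [(e, i), (\<not> e, i)] []"
    unfolding artin_step_def
    using w(2) by (auto intro!: exI[of _ "[]"] artin_relation.cancel)
  ultimately show ?case
    by (auto simp: x braid_inverse_def intro: equivclp_trans)
qed (simp add: braid_inverse_def)

lemma word_perm_append: "word_perm (u @ v) = word_perm v \<circ> word_perm u"
  by (induction u rule: word_perm.induct) (auto simp: o_assoc)

text \<open>Adjacent transpositions satisfy the Artin relations, and being involutions they do not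
  see the sign of a crossing.\<close>

lemma word_perm_artin: "artin_relation u v \<Longrightarrow> word_perm u = word_perm v"
  by (induction rule: artin_relation.induct) (auto simp: fun_eq_iff transpose_def)

lemma word_perm_equiv: "braid_equiv n u v \<Longrightarrow> word_perm u = word_perm v"
proof (induction rule: equivclp_induct)
  case (step v w)
  then show ?case
    using word_perm_artin by (auto simp: artin_step_def word_perm_append)
qed simp

text \<open>Invariance under Artin moves makes the image of a class under \<open>word_perm\<close> a
  singleton, so \<open>the_elem\<close> returns a meaningful value.\<close>

lemma braid_gperm:
  assumes "u \<in> braid_words n"
  shows "gperm braid_operad (braid_class n u) = word_perm u"
proof -
  have "word_perm ` braid_class n u = {word_perm u}"
    using assms word_perm_equiv by (force simp: braid_class_def)
  then show ?thesis
    by (simp add: braid_operad_def)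
qed

lemma word_perm_permutes: "w \<in> braid_words n \<Longrightarrow> word_perm w permutes {..<n}"
  by (induction w rule: word_perm.induct)
    (auto simp: permutes_id intro!: permutes_compose permutes_swap_id)

lemma braid_gcarrier: "gcarrier braid_operad n = braid_class n ` braid_words n"
  by (simp add: braid_operad_def)

lemma braid_gone: "gone braid_operad n = braid_class n []"
  by (simp add: braid_operad_def)

interpretation braid: operad_groups braid_operad
proof
  show "\<exists>h \<in> gcarrier braid_operad n. gmult braid_operad n h g = gone braid_operad n \<and>
      gmult braid_operad n g h = gone braid_operad n"
    if g: "g \<in> gcarrier braid_operad n" for g n
  proof -
    obtain w where w: "w \<in> braid_words n" "g = braid_class n w"
      using g by (auto simp: braid_gcarrier)
    note w' = braid_inverse_words[OF w(1)]
    show ?thesis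
      using braid_inverse_right[OF w(1)] braid_inverse_right[OF w'] w w'
      by (intro bexI[of _ "braid_class n (braid_inverse w)"])
        (auto simp: braid_gcarrier braid_gone braid_gmult braid_class_eq_iff)
  qed
qed (auto simp: braid_gcarrier braid_gone braid_gmult braid_gperm word_perm_permutes
      word_perm_append)


theorem proposition4p5p5:
  shows
    "(\<forall>(A :: (nat \<Rightarrow> nat, 'o, 'a) alg_data) (B :: (nat \<Rightarrow> nat, 'p, 'b) alg_data) F \<Phi>.
        colax_morphism symmetric_operad A B F \<Phi> \<longrightarrow>
        (exact_colax_morphism TYPE(('m, 'n) precat) symmetric_operad A B F \<Phi> \<longleftrightarrow>
         exact_colax_morphism TYPE(('m, 'n) precat) trivial_operad
           (underlying_monoidal symmetric_operad A) (underlying_monoidal symmetric_operad B) F \<Phi>)) \<and>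
     (\<forall>(A :: (braid_word set, 'o, 'a) alg_data) (B :: (braid_word set, 'p, 'b) alg_data) F \<Phi>.
        colax_morphism braid_operad A B F \<Phi> \<longrightarrow>
        (exact_colax_morphism TYPE(('m, 'n) precat) braid_operad A B F \<Phi> \<longleftrightarrow>
         exact_colax_morphism TYPE(('m, 'n) precat) trivial_operad
           (underlying_monoidal braid_operad A) (underlying_monoidal braid_operad B) F \<Phi>))"
  using symmetric.exact_colax_morphism_underlying braid.exact_colax_morphism_underlying by blast

end
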